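(* Let $\mathcal{A}$ be an essentially small abelian length category and let $[\mathcal{U},\mathcal{T}]$ be an interval in $\mathsf{tors}\,\mathcal{A}$. The following conditions are equivalent: (a) $[\mathcal{U},\mathcal{T}]$ is a wide interval; (b) $[\mathcal{U},\mathcal{T}]$ is a join interval; (c) $[\mathcal{U},\mathcal{T}]$ is a meet interval.
   Context: All subcategories are full and closed under isomorphism. An abelian length category is an abelian category in which every object has a finite composition series. For a subcategory $\mathcal{X}\subseteq\mathcal{A}$: $\mathcal{X}^\perp=\{Y\in\mathcal{A}\mid \mathrm{Hom}_{\mathcal{A}}(X,Y)=0 \text{ for all } X\in\mathcal{X}\}$. A torsion class is a subcategory closed under extensions and factor objects; $\mathsf{tors}\,\mathcal{A}$ is the set of torsion classes in $\mathcal{A}$, ordered by inclusion. It is a complete lattice: the meet $\bigwedge$ is intersection and the join $\bigvee$ is the smallest torsion class containing the union. For $\mathcal{U}\subseteq\mathcal{T}$ in $\mathsf{tors}\,\mathcal{A}$, the interval is $[\mathcal{U},\mathcal{T}]=\{\mathcal{V}\in\mathsf{tors}\,\mathcal{A}\mid\mathcal{U}\subseteq\mathcal{V}\subseteq\mathcal{T}\}$. A wide subcategory is one closed under kernels, cokernels and extensions in $\mathcal{A}$. The interval $[\mathcal{U},\mathcal{T}]$ is a wide interval if $\mathcal{U}^\perp\cap\mathcal{T}$ is a wide subcategory of $\mathcal{A}$. The Hasse quiver of $\mathsf{tors}\,\mathcal{A}$ has the torsion classes as vertices and an arrow $\mathcal{V}_1\to\mathcal{V}_2$ iff $\mathcal{V}_2\subsetneq\mathcal{V}_1$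 and there is no torsion class strictly between them. Put $[\mathcal{U},\mathcal{T}]^+=\{\mathcal{T}\}\cup\{\mathcal{V}\in[\mathcal{U},\mathcal{T}]\mid\text{there is a Hasse arrow }\mathcal{T}\to\mathcal{V}\}$ and $[\mathcal{U},\mathcal{T}]^-=\{\mathcal{U}\}\cup\{\mathcal{V}\in[\mathcal{U},\mathcal{T}]\mid\text{there is a Hasse arrow }\mathcal{V}\to\mathcal{U}\}$. The interval $[\mathcal{U},\mathcal{T}]$ is a join interval if $\mathcal{T}=\bigvee[\mathcal{U},\mathcal{T}]^-$, and a meet interval if $\mathcal{U}=\bigwedge[\mathcal{U},\mathcal{T}]^+$. *)

theory Defs
  imports "HOL-Algebra.Group"
begin

section \<open>Abelian length categories\<close>

text \<open>
  Objects and arrows form sets, so the categories considered here are the small ones. Up to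
  equivalence these are all the essentially small categories, and every notion below is invariant
  under equivalence.
\<close>

record ('o, 'a) precategory =
  Obj :: "'o set"
  Arr :: "'a set"
  Dom :: "'a \<Rightarrow> 'o"
  Cod :: "'a \<Rightarrow> 'o"
  Id :: "'o \<Rightarrow> 'a"
  Comp :: "'a \<Rightarrow> 'a \<Rightarrow> 'a"  (infixl "\<cdot>\<index>" 70)
  Add :: "'a \<Rightarrow> 'a \<Rightarrow> 'a"
  Zero :: "'o \<Rightarrow> 'o \<Rightarrow> 'a"

definition Hom :: "('o, 'a, 'x) precategory_scheme \<Rightarrow> 'o \<Rightarrow> 'o \<Rightarrow> 'a set" where
  "Hom C A B = {f \<in> Arr C. Dom C f = A \<and> Cod C f = B}"

definition hom_group :: "('o, 'a, 'x) precategory_scheme \<Rightarrow> 'o \<Rightarrow> 'o \<Rightarrow> 'a monoid" where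
  "hom_group C A B = \<lparr>carrier = Hom C A B, mult = Add C, one = Zero C A B\<rparr>"

locale category =
  fixes C :: "('o, 'a, 'x) precategory_scheme" (structure)
  assumes Dom_Obj: "f \<in> Arr C \<Longrightarrow> Dom C f \<in> Obj C"
    and Cod_Obj: "f \<in> Arr C \<Longrightarrow> Cod C f \<in> Obj C"
    and Id_Hom: "A \<in> Obj C \<Longrightarrow> Id C A \<in> Hom C A A"
    and Comp_Hom: "\<lbrakk>f \<in> Hom C A B; g \<in> Hom C B D\<rbrakk> \<Longrightarrow> g \<cdot> f \<in> Hom C A D"
    and Comp_assoc: "\<lbrakk>f \<in> Hom C A B; g \<in> Hom C B D; h \<in> Hom C D E\<rbrakk> \<Longrightarrow> (h \<cdot> g) \<cdot> f = h \<cdot> (g \<cdot> f)"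
    and Comp_Id_left: "f \<in> Hom C A B \<Longrightarrow> Id C B \<cdot> f = f"
    and Comp_Id_right: "f \<in> Hom C A B \<Longrightarrow> f \<cdot> Id C A = f"

locale preadditive_category = category +
  assumes Hom_comm_group: "\<lbrakk>A \<in> Obj C; B \<in> Obj C\<rbrakk> \<Longrightarrow> comm_group (hom_group C A B)"
    and Comp_Add_right:
      "\<lbrakk>f \<in> Hom C A B; f' \<in> Hom C A B; g \<in> Hom C B D\<rbrakk>
        \<Longrightarrow> g \<cdot> Add C f f' = Add C (g \<cdot> f) (g \<cdot> f')"
    and Comp_Add_left:
      "\<lbrakk>f \<in> Hom C A B; g \<in> Hom C B D; g' \<in> Hom C B D\<rbrakk>
        \<Longrightarrow> Add C g g' \<cdot> f = Add C (g \<cdot> f) (g' \<cdot> f)"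

definition zero_object :: "('o, 'a, 'x) precategory_scheme \<Rightarrow> 'o \<Rightarrow> bool" where
  "zero_object C Z \<longleftrightarrow>
     Z \<in> Obj C \<and> (\<forall>A\<in>Obj C. (\<exists>!f. f \<in> Hom C A Z) \<and> (\<exists>!f. f \<in> Hom C Z A))"

definition is_biproduct ::
    "('o, 'a, 'x) precategory_scheme \<Rightarrow> 'o \<Rightarrow> 'o \<Rightarrow> 'o \<Rightarrow> 'a \<Rightarrow> 'a \<Rightarrow> 'a \<Rightarrow> 'a \<Rightarrow> bool" where
  "is_biproduct C A B P i\<^sub>1 i\<^sub>2 p\<^sub>1 p\<^sub>2 \<longleftrightarrow>
     i\<^sub>1 \<in> Hom C A P \<and> i\<^sub>2 \<in> Hom C B P \<and> p\<^sub>1 \<in> Hom C P A \<and> p\<^sub>2 \<in> Hom C P B \<and>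
     p\<^sub>1 \<cdot>\<^bsub>C\<^esub> i\<^sub>1 = Id C A \<and> p\<^sub>2 \<cdot>\<^bsub>C\<^esub> i\<^sub>2 = Id C B \<and>
     p\<^sub>1 \<cdot>\<^bsub>C\<^esub> i\<^sub>2 = Zero C B A \<and> p\<^sub>2 \<cdot>\<^bsub>C\<^esub> i\<^sub>1 = Zero C A B \<and>
     Add C (i\<^sub>1 \<cdot>\<^bsub>C\<^esub> p\<^sub>1) (i\<^sub>2 \<cdot>\<^bsub>C\<^esub> p\<^sub>2) = Id C P"

definition iso_arrow :: "('o, 'a, 'x) precategory_scheme \<Rightarrow> 'a \<Rightarrow> bool" where
  "iso_arrow C f \<longleftrightarrow> f \<in> Arr C \<and>
     (\<exists>g \<in> Hom C (Cod C f) (Dom C f). g \<cdot>\<^bsub>C\<^esub> f = Id C (Dom C f) \<and> f \<cdot>\<^bsub>C\<^esub> g = Id C (Cod C f))"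

definition isomorphic :: "('o, 'a, 'x) precategory_scheme \<Rightarrow> 'o \<Rightarrow> 'o \<Rightarrow> bool" where
  "isomorphic C A B \<longleftrightarrow> (\<exists>f \<in> Hom C A B. iso_arrow C f)"

definition monic :: "('o, 'a, 'x) precategory_scheme \<Rightarrow> 'a \<Rightarrow> bool" where
  "monic C f \<longleftrightarrow> f \<in> Arr C \<and>
     (\<forall>A\<in>Obj C. \<forall>g \<in> Hom C A (Dom C f). \<forall>h \<in> Hom C A (Dom C f).
        f \<cdot>\<^bsub>C\<^esub> g = f \<cdot>\<^bsub>C\<^esub> h \<longrightarrow> g = h)"

definition epic :: "('o, 'a, 'x) precategory_scheme \<Rightarrow> 'a \<Rightarrow> bool" where
  "epic C f \<longleftrightarrow> f \<in> Arr C \<and>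
     (\<forall>B\<in>Obj C. \<forall>g \<in> Hom C (Cod C f) B. \<forall>h \<in> Hom C (Cod C f) B.
        g \<cdot>\<^bsub>C\<^esub> f = h \<cdot>\<^bsub>C\<^esub> f \<longrightarrow> g = h)"

text \<open>\<open>is_kernel C f k\<close>: the arrow \<open>k\<close> is a kernel of \<open>f\<close>; dually for cokernels.\<close>

definition is_kernel :: "('o, 'a, 'x) precategory_scheme \<Rightarrow> 'a \<Rightarrow> 'a \<Rightarrow> bool" where
  "is_kernel C f k \<longleftrightarrow>
     f \<in> Arr C \<and> k \<in> Arr C \<and> Cod C k = Dom C f \<and>
     f \<cdot>\<^bsub>C\<^esub> k = Zero C (Dom C k) (Cod C f) \<and>
     (\<forall>A\<in>Obj C. \<forall>h \<in> Hom C A (Dom C f). f \<cdot>\<^bsub>C\<^esub> h = Zero C A (Cod C f) \<longrightarrow>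
        (\<exists>!u. u \<in> Hom C A (Dom C k) \<and> k \<cdot>\<^bsub>C\<^esub> u = h))"

definition is_cokernel :: "('o, 'a, 'x) precategory_scheme \<Rightarrow> 'a \<Rightarrow> 'a \<Rightarrow> bool" where
  "is_cokernel C f p \<longleftrightarrow>
     f \<in> Arr C \<and> p \<in> Arr C \<and> Dom C p = Cod C f \<and>
     p \<cdot>\<^bsub>C\<^esub> f = Zero C (Dom C f) (Cod C p) \<and>
     (\<forall>B\<in>Obj C. \<forall>h \<in> Hom C (Cod C f) B. h \<cdot>\<^bsub>C\<^esub> f = Zero C (Dom C f) B \<longrightarrow>
        (\<exists>!u. u \<in> Hom C (Cod C p) B \<and> u \<cdot>\<^bsub>C\<^esub> p = h))"

locale abelian_category = preadditive_category +
  assumes ex_zero_object: "\<exists>Z. zero_object C Z"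
    and ex_biproduct:
      "\<lbrakk>A \<in> Obj C; B \<in> Obj C\<rbrakk> \<Longrightarrow> \<exists>P i\<^sub>1 i\<^sub>2 p\<^sub>1 p\<^sub>2. P \<in> Obj C \<and> is_biproduct C A B P i\<^sub>1 i\<^sub>2 p\<^sub>1 p\<^sub>2"
    and ex_kernel: "f \<in> Arr C \<Longrightarrow> \<exists>k. is_kernel C f k"
    and ex_cokernel: "f \<in> Arr C \<Longrightarrow> \<exists>p. is_cokernel C f p"
    and monic_is_kernel: "monic C k \<Longrightarrow> \<exists>f. is_kernel C f k"
    and epic_is_cokernel: "epic C p \<Longrightarrow> \<exists>f. is_cokernel C f p"

definition simple_object :: "('o, 'a, 'x) precategory_scheme \<Rightarrow> 'o \<Rightarrow> bool" where
  "simple_object C S \<longleftrightarrow> S \<in> Obj C \<and> \<not> zero_object C S \<and>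
     (\<forall>i. monic C i \<and> Cod C i = S \<longrightarrow> zero_object C (Dom C i) \<or> iso_arrow C i)"

text \<open>
  A composition series \<open>0 = X 0 \<subset> X 1 \<subset> \<dots> \<subset> X n = A\<close>, where \<open>i k\<close> is the inclusion of \<open>X k\<close> into
  \<open>X (Suc k)\<close>.
\<close>

definition composition_series ::
    "('o, 'a, 'x) precategory_scheme \<Rightarrow> 'o \<Rightarrow> nat \<Rightarrow> (nat \<Rightarrow> 'o) \<Rightarrow> (nat \<Rightarrow> 'a) \<Rightarrow> bool" where
  "composition_series C A n X i \<longleftrightarrow>
     zero_object C (X 0) \<and> X n = A \<and>
     (\<forall>k<n. i k \<in> Hom C (X k) (X (Suc k)) \<and> monic C (i k) \<and>
        (\<exists>p. is_cokernel C (i k) p \<and> simple_object C (Cod C p)))"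

locale abelian_length_category = abelian_category +
  assumes ex_composition_series: "A \<in> Obj C \<Longrightarrow> \<exists>n X i. composition_series C A n X i"


section \<open>Subcategories\<close>

text \<open>
  A full subcategory is given by its set of objects. Subcategories are nonempty; in particular the
  smallest torsion class consists of the zero objects (and is not the empty class).
\<close>

definition subcategory :: "('o, 'a, 'x) precategory_scheme \<Rightarrow> 'o set \<Rightarrow> bool" where
  "subcategory C X \<longleftrightarrow> X \<subseteq> Obj C \<and> X \<noteq> {} \<and>
     (\<forall>A B. A \<in> X \<and> B \<in> Obj C \<and> isomorphic C A B \<longrightarrow> B \<in> X)"

definition short_exact :: "('o, 'a, 'x) precategory_scheme \<Rightarrow> 'a \<Rightarrow> 'a \<Rightarrow> bool" where
  "short_exact C f g \<longleftrightarrow> is_kernel C g f \<and> is_cokernel C f g"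

definition closed_extensions :: "('o, 'a, 'x) precategory_scheme \<Rightarrow> 'o set \<Rightarrow> bool" where
  "closed_extensions C X \<longleftrightarrow>
     (\<forall>f g. short_exact C f g \<and> Dom C f \<in> X \<and> Cod C g \<in> X \<longrightarrow> Cod C f \<in> X)"

definition closed_factors :: "('o, 'a, 'x) precategory_scheme \<Rightarrow> 'o set \<Rightarrow> bool" where
  "closed_factors C X \<longleftrightarrow> (\<forall>p. epic C p \<and> Dom C p \<in> X \<longrightarrow> Cod C p \<in> X)"

definition closed_kernels :: "('o, 'a, 'x) precategory_scheme \<Rightarrow> 'o set \<Rightarrow> bool" where
  "closed_kernels C X \<longleftrightarrow>
     (\<forall>f k. is_kernel C f k \<and> Dom C f \<in> X \<and> Cod C f \<in> X \<longrightarrow> Dom C k \<in> X)"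

definition closed_cokernels :: "('o, 'a, 'x) precategory_scheme \<Rightarrow> 'o set \<Rightarrow> bool" where
  "closed_cokernels C X \<longleftrightarrow>
     (\<forall>f p. is_cokernel C f p \<and> Dom C f \<in> X \<and> Cod C f \<in> X \<longrightarrow> Cod C p \<in> X)"

definition torsion_class :: "('o, 'a, 'x) precategory_scheme \<Rightarrow> 'o set \<Rightarrow> bool" where
  "torsion_class C T \<longleftrightarrow> subcategory C T \<and> closed_extensions C T \<and> closed_factors C T"

definition wide_subcategory :: "('o, 'a, 'x) precategory_scheme \<Rightarrow> 'o set \<Rightarrow> bool" where
  "wide_subcategory C W \<longleftrightarrow>
     subcategory C W \<and> closed_kernels C W \<and> closed_cokernels C W \<and> closed_extensions C W"

definition right_perp :: "('o, 'a, 'x) precategory_scheme \<Rightarrow> 'o set \<Rightarrow> 'o set" where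
  "right_perp C X = {Y \<in> Obj C. \<forall>A\<in>X. Hom C A Y = {Zero C A Y}}"


section \<open>The lattice of torsion classes\<close>

definition tors :: "('o, 'a, 'x) precategory_scheme \<Rightarrow> 'o set set" where
  "tors C = {T. torsion_class C T}"

definition tors_meet :: "('o, 'a, 'x) precategory_scheme \<Rightarrow> 'o set set \<Rightarrow> 'o set" where
  "tors_meet C \<F> = Obj C \<inter> \<Inter>\<F>"

definition tors_join :: "('o, 'a, 'x) precategory_scheme \<Rightarrow> 'o set set \<Rightarrow> 'o set" where
  "tors_join C \<F> = \<Inter>{V \<in> tors C. \<Union>\<F> \<subseteq> V}"

definition tors_interval :: "('o, 'a, 'x) precategory_scheme \<Rightarrow> 'o set \<Rightarrow> 'o set \<Rightarrow> 'o set set" where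
  "tors_interval C U T = {V \<in> tors C. U \<subseteq> V \<and> V \<subseteq> T}"

definition hasse_arrow :: "('o, 'a, 'x) precategory_scheme \<Rightarrow> 'o set \<Rightarrow> 'o set \<Rightarrow> bool" where
  "hasse_arrow C V\<^sub>1 V\<^sub>2 \<longleftrightarrow> V\<^sub>1 \<in> tors C \<and> V\<^sub>2 \<in> tors C \<and> V\<^sub>2 \<subset> V\<^sub>1 \<and>
     \<not> (\<exists>W \<in> tors C. V\<^sub>2 \<subset> W \<and> W \<subset> V\<^sub>1)"

definition interval_plus :: "('o, 'a, 'x) precategory_scheme \<Rightarrow> 'o set \<Rightarrow> 'o set \<Rightarrow> 'o set set" where
  "interval_plus C U T = {T} \<union> {V \<in> tors_interval C U T. hasse_arrow C T V}"

definition interval_minus :: "('o, 'a, 'x) precategory_scheme \<Rightarrow> 'o set \<Rightarrow> 'o set \<Rightarrow> 'o set set" where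
  "interval_minus C U T = {U} \<union> {V \<in> tors_interval C U T. hasse_arrow C V U}"

definition wide_interval :: "('o, 'a, 'x) precategory_scheme \<Rightarrow> 'o set \<Rightarrow> 'o set \<Rightarrow> bool" where
  "wide_interval C U T \<longleftrightarrow> wide_subcategory C (right_perp C U \<inter> T)"

definition join_interval :: "('o, 'a, 'x) precategory_scheme \<Rightarrow> 'o set \<Rightarrow> 'o set \<Rightarrow> bool" where
  "join_interval C U T \<longleftrightarrow> T = tors_join C (interval_minus C U T)"

definition meet_interval :: "('o, 'a, 'x) precategory_scheme \<Rightarrow> 'o set \<Rightarrow> 'o set \<Rightarrow> bool" where
  "meet_interval C U T \<longleftrightarrow> U = tors_meet C (interval_plus C U T)"

context abelian_length_category
begin

lemma zero_object_in_torsion_class: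
  assumes "torsion_class C T" "zero_object C Z"
  shows "Z \<in> T"
proof -
  from assms obtain A where A: "A \<in> T" "A \<in> Obj C"
    by (auto simp: torsion_class_def subcategory_def)
  with assms(2) obtain p where p: "p \<in> Hom C A Z" by (auto simp: zero_object_def)
  then have "epic C p"
    using assms(2) by (auto simp: zero_object_def epic_def Hom_def)
  with p A assms show ?thesis
    by (auto simp: torsion_class_def closed_factors_def Hom_def)
qed

lemma Obj_in_tors: "Obj C \<in> tors C"
proof -
  have "Obj C \<noteq> {}" using ex_zero_object by (auto simp: zero_object_def)
  moreover have "closed_extensions C (Obj C)"
    by (simp add: closed_extensions_def short_exact_def is_cokernel_def Cod_Obj)
  moreover have "closed_factors C (Obj C)"
    by (simp add: closed_factors_def epic_def Cod_Obj)
  ultimately show ?thesis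
    by (simp add: tors_def torsion_class_def subcategory_def)
qed

lemma tors_meet_in_tors:
  assumes "\<F> \<subseteq> tors C"
  shows "tors_meet C \<F> \<in> tors C"
proof -
  let ?\<G> = "insert (Obj C) \<F>"
  have eq: "tors_meet C \<F> = \<Inter>?\<G>" by (simp add: tors_meet_def)
  have tc: "torsion_class C V" if "V \<in> ?\<G>" for V
    using that assms Obj_in_tors by (auto simp: tors_def)
  obtain Z where Z: "zero_object C Z" using ex_zero_object by blast
  have "\<forall>V\<in>?\<G>. Z \<in> V" using tc Z zero_object_in_torsion_class by blast
  then have "\<Inter>?\<G> \<noteq> {}" by blast
  moreover have "\<Inter>?\<G> \<subseteq> Obj C" by simp
  moreover have "B \<in> \<Inter>?\<G>" if "A \<in> \<Inter>?\<G>" "B \<in> Obj C" "isomorphic C A B" for A B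
  proof (rule InterI)
    fix V assume "V \<in> ?\<G>"
    with tc that(1) have "subcategory C V" "A \<in> V" by (simp_all only: torsion_class_def Inter_iff)
    with that(2,3) show "B \<in> V" unfolding subcategory_def by metis
  qed
  moreover have "closed_extensions C (\<Inter>?\<G>)"
    unfolding closed_extensions_def
  proof (intro allI impI InterI)
    fix f g V
    assume f: "short_exact C f g \<and> Dom C f \<in> \<Inter>?\<G> \<and> Cod C g \<in> \<Inter>?\<G>" and V: "V \<in> ?\<G>"
    from tc[OF V] have "closed_extensions C V" by (simp only: torsion_class_def)
    moreover from f V have "Dom C f \<in> V" "Cod C g \<in> V" by blast+
    ultimately show "Cod C f \<in> V" using f unfolding closed_extensions_def by metis
  qed
  moreover have "closed_factors C (\<Inter>?\<G>)"
    unfolding closed_factors_def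
  proof (intro allI impI InterI)
    fix p V
    assume p: "epic C p \<and> Dom C p \<in> \<Inter>?\<G>" and V: "V \<in> ?\<G>"
    from tc[OF V] have "closed_factors C V" by (simp only: torsion_class_def)
    moreover from p V have "Dom C p \<in> V" by blast
    ultimately show "Cod C p \<in> V" using p unfolding closed_factors_def by metis
  qed
  ultimately show ?thesis
    unfolding eq tors_def torsion_class_def subcategory_def by (simp only: mem_Collect_eq) metis
qed

lemma tors_join_least:
  assumes "\<F> \<subseteq> tors C"
  shows "tors_join C \<F> \<in> tors C" "\<Union>\<F> \<subseteq> tors_join C \<F>"
    and "\<lbrakk>V \<in> tors C; \<Union>\<F> \<subseteq> V\<rbrakk> \<Longrightarrow> tors_join C \<F> \<subseteq> V"
proof -
  have "\<Union>\<F> \<subseteq> Obj C"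
    using assms by (auto simp: tors_def torsion_class_def subcategory_def)
  then have "tors_join C \<F> = tors_meet C {V \<in> tors C. \<Union>\<F> \<subseteq> V}"
    using Obj_in_tors by (auto simp: tors_join_def tors_meet_def)
  then show "tors_join C \<F> \<in> tors C" using tors_meet_in_tors by simp
qed (auto simp: tors_join_def)

end

end

theory Submission
  imports Defs
begin

text \<open>
  Let \<open>H\<close> be the intersection of \<open>T\<close> with the right perpendicular category of \<open>U\<close>. If \<open>H\<close> is wide,
  an object \<open>X\<close> of \<open>H\<close> that is simple in \<open>H\<close> generates together with \<open>U\<close> a cover of \<open>U\<close>, because
  every nonzero object of \<open>H\<close> in the generated torsion class surjects onto \<open>X\<close>; induction on length
  then puts all of \<open>T\<close> into the join of these covers. Conversely, for a cover \<open>V\<close> of \<open>U\<close> let \<open>S\<close> be a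
  nonzero object of minimal length in the part of \<open>V\<close> right perpendicular to \<open>U\<close>. Every nonzero map
  from \<open>S\<close> to an object of \<open>H\<close> is a monomorphism with cokernel in \<open>H\<close>, and for a join interval every
  nonzero object of \<open>H\<close> receives such a map. Splitting off these subobjects, induction on length
  shows that kernels and cokernels stay in \<open>H\<close>. The statement on meet intervals is the one on
  join intervals in the opposite category: taking right perpendicular categories reverses the order
  of torsion classes and preserves \<open>H\<close>.
\<close>

section \<open>Additive categories and their opposites\<close>

context category
begin

lemma Hom_Obj: "f \<in> Hom C A B \<Longrightarrow> A \<in> Obj C" "f \<in> Hom C A B \<Longrightarrow> B \<in> Obj C"
  using Dom_Obj Cod_Obj by (auto simp: Hom_def)

lemma Hom_DomCod: "f \<in> Hom C A B \<Longrightarrow> Dom C f = A" "f \<in> Hom C A B \<Longrightarrow> Cod C f = B"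
  "f \<in> Hom C A B \<Longrightarrow> f \<in> Arr C"
  by (auto simp: Hom_def)

lemma HomI: "f \<in> Arr C \<Longrightarrow> f \<in> Hom C (Dom C f) (Cod C f)"
  by (auto simp: Hom_def)

end

context preadditive_category
begin

lemma Zero_Hom: "\<lbrakk>A \<in> Obj C; B \<in> Obj C\<rbrakk> \<Longrightarrow> Zero C A B \<in> Hom C A B"
  using monoid.one_closed[of "hom_group C A B"] Hom_comm_group[of A B]
  by (simp add: hom_group_def comm_group_def group_def)

lemma Add_Zero:
  assumes "f \<in> Hom C A B"
  shows "Add C f (Zero C A B) = f" "Add C (Zero C A B) f = f"
  using monoid.r_one[of "hom_group C A B"] monoid.l_one[of "hom_group C A B"]
    Hom_comm_group[of A B] Hom_Obj[of f A B] assms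
  by (simp_all add: hom_group_def comm_group_def group_def)

lemma Add_eq_right_iff:
  assumes "f \<in> Hom C A B" "g \<in> Hom C A B"
  shows "Add C f g = g \<longleftrightarrow> f = Zero C A B"
  using group.r_cancel_one[of "hom_group C A B" g f] Hom_comm_group[of A B] Hom_Obj[of f A B] assms
  by (simp add: hom_group_def comm_group_def group_def)

text \<open>The record has an addition of arrows but no subtraction, so a difference is supplied as
  a solution \<open>d\<close>, built from the inverse in \<open>hom_group\<close>.\<close>

lemma ex_difference:
  assumes "f \<in> Hom C A B" "g \<in> Hom C A B"
  shows "\<exists>d \<in> Hom C A B. Add C d g = f"
proof -
  interpret G: comm_group "hom_group C A B" using Hom_comm_group Hom_Obj assms by blast
  have fg: "f \<in> carrier (hom_group C A B)" "g \<in> carrier (hom_group C A B)"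
    using assms by (simp_all add: hom_group_def)
  then have "f \<otimes>\<^bsub>hom_group C A B\<^esub> inv\<^bsub>hom_group C A B\<^esub> g \<in> carrier (hom_group C A B)"
    and "f \<otimes>\<^bsub>hom_group C A B\<^esub> inv\<^bsub>hom_group C A B\<^esub> g \<otimes>\<^bsub>hom_group C A B\<^esub> g = f"
    by (simp_all add: G.m_assoc)
  then show ?thesis unfolding hom_group_def by auto
qed

lemma Comp_Zero_right:
  assumes "g \<in> Hom C B D" "A \<in> Obj C"
  shows "g \<cdot> Zero C A B = Zero C A D"
proof -
  have z: "Zero C A B \<in> Hom C A B" using assms Hom_Obj Zero_Hom by blast
  \<comment> \<open>An arrow equal to its own double is zero.\<close>
  have "Add C (g \<cdot> Zero C A B) (g \<cdot> Zero C A B) = g \<cdot> Zero C A B"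
    using Comp_Add_right[OF z z assms(1)] Add_Zero[OF z] by simp
  then show ?thesis using Add_eq_right_iff Comp_Hom[OF z assms(1)] by blast
qed

lemma Comp_Zero_left:
  assumes "f \<in> Hom C A B" "D \<in> Obj C"
  shows "Zero C B D \<cdot> f = Zero C A D"
proof -
  have z: "Zero C B D \<in> Hom C B D" using assms Hom_Obj Zero_Hom by blast
  have "Add C (Zero C B D \<cdot> f) (Zero C B D \<cdot> f) = Zero C B D \<cdot> f"
    using Comp_Add_left[OF assms(1) z z] Add_Zero[OF z] by simp
  then show ?thesis using Add_eq_right_iff Comp_Hom[OF assms(1) z] by blast
qed

lemma monic_iff:
  assumes f: "f \<in> Hom C A B"
  shows "monic C f \<longleftrightarrow> (\<forall>X h. h \<in> Hom C X A \<and> f \<cdot> h = Zero C X B \<longrightarrow> h = Zero C X A)"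
proof
  assume m: "monic C f"
  show "\<forall>X h. h \<in> Hom C X A \<and> f \<cdot> h = Zero C X B \<longrightarrow> h = Zero C X A"
  proof (intro allI impI)
    fix X h assume h: "h \<in> Hom C X A \<and> f \<cdot> h = Zero C X B"
    then have "X \<in> Obj C" "A \<in> Obj C" using Hom_Obj by blast+
    moreover have "f \<cdot> h = f \<cdot> Zero C X A" using h f Comp_Zero_right Hom_Obj by metis
    ultimately show "h = Zero C X A"
      using m h f Zero_Hom unfolding monic_def by (metis Hom_DomCod(1))
  qed
next
  assume z: "\<forall>X h. h \<in> Hom C X A \<and> f \<cdot> h = Zero C X B \<longrightarrow> h = Zero C X A"
  have "g = h" if gh: "g \<in> Hom C X A" "h \<in> Hom C X A" "f \<cdot> g = f \<cdot> h" for X g h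
  proof -
    \<comment> \<open>The difference of \<open>g\<close> and \<open>h\<close> is killed by
      \<open>f\<close>; this reduces cancellation to the test on zero arrows.\<close>
    obtain d where d: "d \<in> Hom C X A" "Add C d h = g" using ex_difference[OF gh(1,2)] by blast
    have "Add C (f \<cdot> d) (f \<cdot> h) = f \<cdot> h" using Comp_Add_right[OF d(1) gh(2) f] d(2) gh(3) by simp
    then have "f \<cdot> d = Zero C X B" using Add_eq_right_iff Comp_Hom f d(1) gh(2) by meson
    then have "d = Zero C X A" using z d(1) by blast
    then show "g = h" using d(2) Add_Zero(2)[OF gh(2)] by simp
  qed
  then show "monic C f" using f unfolding monic_def by (auto simp: Hom_DomCod)
qed

end

section \<open>The opposite category\<close>

definition opposite :: "('o, 'a, 'x) precategory_scheme \<Rightarrow> ('o, 'a) precategory" where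
  "opposite C = \<lparr>Obj = Obj C, Arr = Arr C, Dom = Cod C, Cod = Dom C, Id = Id C,
     Comp = (\<lambda>f g. Comp C g f), Add = Add C, Zero = (\<lambda>A B. Zero C B A)\<rparr>"

lemma opposite_simps [simp]:
  "Obj (opposite C) = Obj C" "Arr (opposite C) = Arr C"
  "Dom (opposite C) = Cod C" "Cod (opposite C) = Dom C" "Id (opposite C) = Id C"
  "Comp (opposite C) f g = Comp C g f" "Add (opposite C) = Add C"
  "Zero (opposite C) A B = Zero C B A"
  by (simp_all add: opposite_def)

lemma Hom_opposite [simp]: "Hom (opposite C) A B = Hom C B A"
  by (auto simp: Hom_def)

text \<open>Duality is phrased as equality of predicates on the same arrows, so that a lemma
  instantiated at \<open>opposite C\<close> simplifies to its dual over \<open>C\<close>.\<close>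

lemma monic_opposite [simp]: "monic (opposite C) = epic C"
  by (simp add: monic_def epic_def fun_eq_iff)

lemma epic_opposite [simp]: "epic (opposite C) = monic C"
  by (simp add: monic_def epic_def fun_eq_iff)

lemma is_kernel_opposite [simp]: "is_kernel (opposite C) = is_cokernel C"
  by (simp add: is_kernel_def is_cokernel_def fun_eq_iff)

lemma is_cokernel_opposite [simp]: "is_cokernel (opposite C) = is_kernel C"
  by (simp add: is_kernel_def is_cokernel_def fun_eq_iff)

lemma short_exact_opposite [simp]: "short_exact (opposite C) f g = short_exact C g f"
  by (auto simp: short_exact_def)

lemma zero_object_opposite [simp]: "zero_object (opposite C) = zero_object C"
  by (auto simp: zero_object_def fun_eq_iff)

lemma is_biproduct_opposite:
  "is_biproduct (opposite C) A B P p\<^sub>1 p\<^sub>2 i\<^sub>1 i\<^sub>2 = is_biproduct C A B P i\<^sub>1 i\<^sub>2 p\<^sub>1 p\<^sub>2"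
  by (auto simp: is_biproduct_def)

lemma iso_arrow_opposite [simp]: "iso_arrow (opposite C) = iso_arrow C"
  by (auto simp: iso_arrow_def fun_eq_iff)

lemma (in category) isomorphic_sym: "isomorphic C A B \<Longrightarrow> isomorphic C B A"
  unfolding isomorphic_def iso_arrow_def by (metis Hom_DomCod)

lemma (in category) category_opposite: "category (opposite C)"
  by unfold_locales
    (auto simp: Dom_Obj Cod_Obj Id_Hom Comp_Hom Comp_assoc Comp_Id_left Comp_Id_right)

lemma (in category) isomorphic_opposite [simp]: "isomorphic (opposite C) = isomorphic C"
proof -
  have "isomorphic (opposite C) A B = isomorphic C B A" for A B
    by (simp add: isomorphic_def)
  then show ?thesis using isomorphic_sym by (auto simp: fun_eq_iff)
qed

lemma (in preadditive_category) preadditive_category_opposite: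
  "preadditive_category (opposite C)"
proof -
  have "hom_group (opposite C) A B = hom_group C B A" for A B
    by (simp add: hom_group_def)
  then show ?thesis
    by (intro preadditive_category.intro preadditive_category_axioms.intro category_opposite)
      (simp_all add: Hom_comm_group Comp_Add_left Comp_Add_right)
qed

lemma (in abelian_category) abelian_category_opposite: "abelian_category (opposite C)"
proof -
  interpret O: preadditive_category "opposite C" by (rule preadditive_category_opposite)
  show ?thesis
  proof
    show "\<exists>Z. zero_object (opposite C) Z" using ex_zero_object by simp
    fix A B assume "A \<in> Obj (opposite C)" "B \<in> Obj (opposite C)"
    then obtain P i\<^sub>1 i\<^sub>2 p\<^sub>1 p\<^sub>2 where "P \<in> Obj C" "is_biproduct C A B P i\<^sub>1 i\<^sub>2 p\<^sub>1 p\<^sub>2"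
      using ex_biproduct[of A B] by auto
    then show "\<exists>P i\<^sub>1 i\<^sub>2 p\<^sub>1 p\<^sub>2. P \<in> Obj (opposite C) \<and> is_biproduct (opposite C) A B P i\<^sub>1 i\<^sub>2 p\<^sub>1 p\<^sub>2"
      unfolding is_biproduct_opposite[symmetric, of C] opposite_simps by blast
  qed (simp_all add: ex_kernel ex_cokernel monic_is_kernel epic_is_cokernel)
qed

section \<open>Monic and epic arrows, kernels and cokernels\<close>

context preadditive_category
begin

lemma monicD:
  assumes "monic C f" "f \<in> Hom C A B" "f \<cdot> h = Zero C X B" "h \<in> Hom C X A"
  shows "h = Zero C X A"
  using assms monic_iff by blast

lemma epic_iff:
  assumes f: "f \<in> Hom C A B"
  shows "epic C f \<longleftrightarrow> (\<forall>X h. h \<in> Hom C B X \<and> h \<cdot> f = Zero C A X \<longrightarrow> h = Zero C B X)"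
  using preadditive_category.monic_iff[OF preadditive_category_opposite, of f B A] f by simp

lemma epicD:
  assumes "epic C f" "f \<in> Hom C A B" "h \<cdot> f = Zero C A X" "h \<in> Hom C B X"
  shows "h = Zero C B X"
  using assms epic_iff by blast

lemma monic_cancel:
  assumes "monic C f" "f \<in> Hom C A B" "f \<cdot> g = f \<cdot> h" "g \<in> Hom C X A" "h \<in> Hom C X A"
  shows "g = h"
  using assms unfolding monic_def by (metis Hom_DomCod(1) Hom_Obj(1))

lemma epic_cancel:
  assumes "epic C f" "f \<in> Hom C A B" "g \<cdot> f = h \<cdot> f" "g \<in> Hom C B X" "h \<in> Hom C B X"
  shows "g = h"
  using assms unfolding epic_def by (metis Hom_DomCod(2) Hom_Obj(2))

lemma monic_comp:
  assumes "monic C f" "f \<in> Hom C A B" "monic C g" "g \<in> Hom C B D"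
  shows "monic C (g \<cdot> f)"
  unfolding monic_iff[OF Comp_Hom[OF assms(2,4)]]
proof (intro allI impI)
  fix X h assume h: "h \<in> Hom C X A \<and> g \<cdot> f \<cdot> h = Zero C X D"
  then have fh: "f \<cdot> h \<in> Hom C X B" using Comp_Hom assms(2) by blast
  have "g \<cdot> (f \<cdot> h) = Zero C X D" using h Comp_assoc assms(2,4) by metis
  then have "f \<cdot> h = Zero C X B" using monicD[OF assms(3,4)] fh by blast
  then show "h = Zero C X A" using monicD[OF assms(1,2)] h by blast
qed

lemma epic_comp:
  assumes "epic C f" "f \<in> Hom C A B" "epic C g" "g \<in> Hom C B D"
  shows "epic C (g \<cdot> f)"
  using preadditive_category.monic_comp[OF preadditive_category_opposite, of g D B f A] assms
  by simp

lemma monic_left_factor: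
  assumes "monic C (g \<cdot> f)" "f \<in> Hom C A B" "g \<in> Hom C B D"
  shows "monic C f"
  unfolding monic_iff[OF assms(2)]
proof (intro allI impI)
  fix X h assume h: "h \<in> Hom C X A \<and> f \<cdot> h = Zero C X B"
  then have "g \<cdot> f \<cdot> h = g \<cdot> Zero C X B" using Comp_assoc assms(2,3) by metis
  also have "\<dots> = Zero C X D" using Comp_Zero_right assms(3) h Hom_Obj by blast
  finally show "h = Zero C X A" using monicD[OF assms(1) Comp_Hom[OF assms(2,3)]] h by blast
qed

lemma epic_right_factor:
  assumes "epic C (g \<cdot> f)" "f \<in> Hom C A B" "g \<in> Hom C B D"
  shows "epic C g"
  using preadditive_category.monic_left_factor[OF preadditive_category_opposite, of f g D B A] assms
  by simp

text \<open>Unique factorisation splits into existence and monicity of \<open>k\<close>. Monicity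
  comes from the uniqueness of the factorisation of a zero arrow.\<close>

lemma is_kernel_iff:
  assumes f: "f \<in> Hom C A B" and k: "k \<in> Hom C K A"
  shows "is_kernel C f k \<longleftrightarrow> monic C k \<and> f \<cdot> k = Zero C K B \<and>
    (\<forall>X h. h \<in> Hom C X A \<and> f \<cdot> h = Zero C X B \<longrightarrow> (\<exists>u \<in> Hom C X K. k \<cdot> u = h))"
proof
  assume ker: "is_kernel C f k"
  have fk: "f \<cdot> k = Zero C K B" using ker f k by (simp add: is_kernel_def Hom_DomCod)
  have u: "\<exists>!u. u \<in> Hom C X K \<and> k \<cdot> u = h" if "h \<in> Hom C X A" "f \<cdot> h = Zero C X B" for X h
    using ker that f k Hom_Obj unfolding is_kernel_def by (metis Hom_DomCod(1,2))
  have "h = Zero C X K" if "h \<in> Hom C X K" "k \<cdot> h = Zero C X A" for X h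
  proof -
    have X: "X \<in> Obj C" and K: "K \<in> Obj C" and A: "A \<in> Obj C" using that k Hom_Obj by blast+
    have "\<exists>!u. u \<in> Hom C X K \<and> k \<cdot> u = Zero C X A"
      using u[OF Zero_Hom[OF X A]] Comp_Zero_right[OF f X] by simp
    then show ?thesis using that Zero_Hom[OF X K] Comp_Zero_right[OF k X] by blast
  qed
  then show "monic C k \<and> f \<cdot> k = Zero C K B \<and>
    (\<forall>X h. h \<in> Hom C X A \<and> f \<cdot> h = Zero C X B \<longrightarrow> (\<exists>u \<in> Hom C X K. k \<cdot> u = h))"
    using fk u monic_iff[OF k] by blast
next
  assume r: "monic C k \<and> f \<cdot> k = Zero C K B \<and>
    (\<forall>X h. h \<in> Hom C X A \<and> f \<cdot> h = Zero C X B \<longrightarrow> (\<exists>u \<in> Hom C X K. k \<cdot> u = h))"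
  have "\<exists>!u. u \<in> Hom C X K \<and> k \<cdot> u = h" if "h \<in> Hom C X A" "f \<cdot> h = Zero C X B" for X h
    using r that monic_cancel[OF _ k] by metis
  then show "is_kernel C f k" using r f k by (simp add: is_kernel_def Hom_DomCod)
qed

lemma is_cokernel_iff:
  assumes f: "f \<in> Hom C A B" and p: "p \<in> Hom C B Q"
  shows "is_cokernel C f p \<longleftrightarrow> epic C p \<and> p \<cdot> f = Zero C A Q \<and>
    (\<forall>X h. h \<in> Hom C B X \<and> h \<cdot> f = Zero C A X \<longrightarrow> (\<exists>u \<in> Hom C Q X. u \<cdot> p = h))"
  using preadditive_category.is_kernel_iff[OF preadditive_category_opposite, of f B A p Q] f p
  by simp

lemma is_kernel_Hom: "\<lbrakk>is_kernel C f k; f \<in> Hom C A B\<rbrakk> \<Longrightarrow> k \<in> Hom C (Dom C k) A"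
  by (auto simp: is_kernel_def Hom_def)

lemma is_cokernel_Hom: "\<lbrakk>is_cokernel C f p; f \<in> Hom C A B\<rbrakk> \<Longrightarrow> p \<in> Hom C B (Cod C p)"
  by (auto simp: is_cokernel_def Hom_def)

lemma iso_arrow_iff:
  assumes "f \<in> Hom C A B"
  shows "iso_arrow C f \<longleftrightarrow> (\<exists>g \<in> Hom C B A. g \<cdot> f = Id C A \<and> f \<cdot> g = Id C B)"
  using assms by (simp add: iso_arrow_def Hom_DomCod)

lemma kernel_iso:
  assumes f: "f \<in> Hom C A B" and k: "k \<in> Hom C K A" "is_kernel C f k"
    and l: "l \<in> Hom C L A" "is_kernel C f l"
  shows "isomorphic C K L"
proof -
  have mk: "monic C k" and ml: "monic C l" using is_kernel_iff f k l by blast+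
  obtain u where u: "u \<in> Hom C K L" "l \<cdot> u = k" using is_kernel_iff f k l by meson
  obtain v where v: "v \<in> Hom C L K" "k \<cdot> v = l" using is_kernel_iff f k l by meson
  have "k \<cdot> (v \<cdot> u) = k \<cdot> Id C K" "l \<cdot> (u \<cdot> v) = l \<cdot> Id C L"
    using u v k l Comp_assoc Comp_Id_right by metis+
  then have "v \<cdot> u = Id C K" "u \<cdot> v = Id C L"
    using monic_cancel[OF mk k(1)] monic_cancel[OF ml l(1)] u(1) v(1) Comp_Hom Id_Hom Hom_Obj by metis+
  then show ?thesis unfolding isomorphic_def using u(1) v(1) iso_arrow_iff by blast
qed

lemma cokernel_iso:
  assumes f: "f \<in> Hom C A B" and p: "p \<in> Hom C B P" "is_cokernel C f p"
    and q: "q \<in> Hom C B Q" "is_cokernel C f q"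
  shows "isomorphic C P Q"
  using preadditive_category.kernel_iso[OF preadditive_category_opposite, of f B A p P q Q]
  using assms by simp

lemma split_epic:
  assumes "f \<in> Hom C A B" "g \<in> Hom C B A" "f \<cdot> g = Id C B"
  shows "epic C f"
  unfolding epic_iff[OF assms(1)]
proof (intro allI impI)
  fix X h assume h: "h \<in> Hom C B X \<and> h \<cdot> f = Zero C A X"
  then have "h = h \<cdot> f \<cdot> g"
    using Comp_assoc[OF assms(2,1)] Comp_Id_right assms(3) by metis
  also have "\<dots> = Zero C B X" using h Comp_Zero_left[OF assms(2)] Hom_Obj(2)[of h B X] by simp
  finally show "h = Zero C B X" .
qed

text \<open>Once the identity vanishes, every arrow into or out of \<open>Z\<close> is its own
  composite with a zero arrow.\<close>

lemma zero_object_iff: "zero_object C Z \<longleftrightarrow> Z \<in> Obj C \<and> Id C Z = Zero C Z Z"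
proof
  assume "zero_object C Z"
  then show "Z \<in> Obj C \<and> Id C Z = Zero C Z Z"
    using Id_Hom Zero_Hom unfolding zero_object_def by blast
next
  assume z: "Z \<in> Obj C \<and> Id C Z = Zero C Z Z"
  have "f = Zero C A Z" if "f \<in> Hom C A Z" for A f
    using z that by (metis Comp_Id_left Comp_Zero_left)
  moreover have "f = Zero C Z A" if "f \<in> Hom C Z A" for A f
    using z that by (metis Comp_Id_right Comp_Zero_right)
  ultimately show "zero_object C Z" using z Zero_Hom unfolding zero_object_def by blast
qed

lemma zero_object_Hom:
  assumes "zero_object C Z"
  shows "f \<in> Hom C Z A \<Longrightarrow> f = Zero C Z A" "f \<in> Hom C A Z \<Longrightarrow> f = Zero C A Z"
  using assms Zero_Hom[of Z A] Zero_Hom[of A Z] Hom_Obj[of f]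
  unfolding zero_object_def by blast+

lemma monic_zero_object:
  assumes "monic C f" "f \<in> Hom C A B" "f = Zero C A B"
  shows "zero_object C A"
proof -
  have A: "A \<in> Obj C" using assms(2) Hom_Obj by blast
  have "f \<cdot> Id C A = Zero C A B" using assms(2,3) Comp_Id_right by metis
  then have "Id C A = Zero C A A" using monicD[OF assms(1,2)] Id_Hom[OF A] by blast
  then show ?thesis using A zero_object_iff by blast
qed

lemma epic_zero_object:
  assumes "epic C f" "f \<in> Hom C A B" "f = Zero C A B"
  shows "zero_object C B"
  using preadditive_category.monic_zero_object[OF preadditive_category_opposite, of f B A] assms
  by simp

end

section \<open>Short exact sequences\<close>

definition ses :: "('o, 'a, 'x) precategory_scheme \<Rightarrow> 'o \<Rightarrow> 'o \<Rightarrow> 'o \<Rightarrow> 'a \<Rightarrow> 'a \<Rightarrow> bool" where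
  "ses C A B D f g \<longleftrightarrow> f \<in> Hom C A B \<and> g \<in> Hom C B D \<and> short_exact C f g"

lemma ses_opposite [simp]: "ses (opposite C) D B A g f \<longleftrightarrow> ses C A B D f g"
  by (auto simp: ses_def)

context abelian_category
begin

lemma sesD:
  assumes "ses C A B D f g"
  shows "f \<in> Hom C A B" "g \<in> Hom C B D" "monic C f" "epic C g" "g \<cdot> f = Zero C A D"
    and "is_kernel C g f" "is_cokernel C f g"
    and "A \<in> Obj C" "B \<in> Obj C" "D \<in> Obj C"
proof -
  show fg: "f \<in> Hom C A B" "g \<in> Hom C B D" and k: "is_kernel C g f" and c: "is_cokernel C f g"
    using assms by (auto simp: ses_def short_exact_def)
  show "monic C f" "epic C g" "g \<cdot> f = Zero C A D"
    using k c is_kernel_iff[OF fg(2,1)] is_cokernel_iff[OF fg] by auto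
  show "A \<in> Obj C" "B \<in> Obj C" "D \<in> Obj C" using fg Hom_Obj by blast+
qed

lemma ses_lift:
  assumes "ses C A B D f g" "h \<in> Hom C X B" "g \<cdot> h = Zero C X D"
  obtains u where "u \<in> Hom C X A" "f \<cdot> u = h"
  using assms is_kernel_iff[OF sesD(2,1)[OF assms(1)]] sesD(6)[OF assms(1)] by blast

lemma ses_colift:
  assumes "ses C A B D f g" "h \<in> Hom C B X" "h \<cdot> f = Zero C A X"
  obtains u where "u \<in> Hom C D X" "u \<cdot> g = h"
  using assms is_cokernel_iff[OF sesD(1,2)[OF assms(1)]] sesD(7)[OF assms(1)] by blast

text \<open>The epic arrow \<open>g\<close> is a cokernel of some \<open>h\<close>, and
  \<open>h\<close> factors through the kernel \<open>f\<close>. An arrow that kills \<open>f\<close>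
  thus kills \<open>h\<close> and factors through \<open>g\<close>.\<close>

lemma ses_epicI:
  assumes f: "f \<in> Hom C A B" and g: "g \<in> Hom C B D" "epic C g" and k: "is_kernel C g f"
  shows "ses C A B D f g"
proof -
  obtain h where h: "is_cokernel C h g" using epic_is_cokernel g(2) by blast
  define X where "X = Dom C h"
  have hX: "h \<in> Hom C X B"
    using h g(1) by (auto simp: X_def is_cokernel_def Hom_def)
  have gh: "g \<cdot> h = Zero C X D" using h is_cokernel_iff[OF hX g(1)] by blast
  have gf: "g \<cdot> f = Zero C A D" using k is_kernel_iff[OF g(1) f] by blast
  obtain u where u: "u \<in> Hom C X A" "f \<cdot> u = h"
    using k is_kernel_iff[OF g(1) f] hX gh by blast
  have "\<exists>v\<in>Hom C D Y. v \<cdot> g = t" if t: "t \<in> Hom C B Y" "t \<cdot> f = Zero C A Y" for Y t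
  proof -
    have "t \<cdot> h = t \<cdot> f \<cdot> u" using Comp_assoc[OF u(1) f t(1)] u(2) by simp
    also have "\<dots> = Zero C X Y" using Comp_Zero_left[OF u(1)] t Hom_Obj(2)[OF t(1)] by simp
    finally show ?thesis using h is_cokernel_iff[OF hX g(1)] t(1) by blast
  qed
  then have "is_cokernel C f g" using is_cokernel_iff[OF f g(1)] g(2) gf by blast
  then show ?thesis using f g k by (simp add: ses_def short_exact_def)
qed

lemma ses_monicI:
  assumes "f \<in> Hom C A B" "monic C f" "g \<in> Hom C B D" "is_cokernel C f g"
  shows "ses C A B D f g"
  using abelian_category.ses_epicI[OF abelian_category_opposite, of g D B f A] assms by simp

lemma ses_of_epic:
  assumes "g \<in> Hom C B D" "epic C g"
  obtains A f where "ses C A B D f g"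
proof -
  obtain f where "is_kernel C g f" using ex_kernel Hom_DomCod(3)[OF assms(1)] by blast
  then show ?thesis using that ses_epicI is_kernel_Hom assms by blast
qed

lemma ses_of_monic:
  assumes "f \<in> Hom C A B" "monic C f"
  obtains D g where "ses C A B D f g"
proof -
  obtain g where "is_cokernel C f g" using ex_cokernel Hom_DomCod(3)[OF assms(1)] by blast
  then show ?thesis using that ses_monicI is_cokernel_Hom assms by blast
qed

section \<open>Images, quotients and preimages of subobjects\<close>

lemma image_factorisation:
  assumes f: "f \<in> Hom C A B"
  obtains I e m where "e \<in> Hom C A I" "epic C e" "m \<in> Hom C I B" "monic C m" "m \<cdot> e = f"
proof -
  obtain p where p: "is_cokernel C f p" using ex_cokernel Hom_DomCod(3)[OF f] by blast
  define P where "P = Cod C p"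
  have pH: "p \<in> Hom C B P" using is_cokernel_Hom[OF p f] by (simp add: P_def)
  have pf: "p \<cdot> f = Zero C A P" and "epic C p" using p is_cokernel_iff[OF f pH] by auto
  then obtain I m where m: "ses C I B P m p" using ses_of_epic[OF pH] by blast
  note mH = sesD(1)[OF m]
  obtain e where e: "e \<in> Hom C A I" "m \<cdot> e = f" using ses_lift[OF m f pf] .
  \<comment> \<open>The image \<open>I\<close> is the kernel of the cokernel of \<open>f\<close>; it
    remains to see that \<open>e\<close> is epic. If \<open>h\<close> kills \<open>e\<close>, then
    \<open>f\<close> factors through the smaller subobject \<open>m \<cdot> k\<close>. Its cokernel
    \<open>t\<close> kills \<open>f\<close>, hence factors through \<open>p\<close> and kills
    \<open>m\<close>. So \<open>m\<close> factors through \<open>m \<cdot> k\<close>, which makes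
    \<open>k\<close> split epic and \<open>h\<close> zero.\<close>
  have "h = Zero C I X" if h: "h \<in> Hom C I X" "h \<cdot> e = Zero C A X" for X h
  proof -
    have X: "X \<in> Obj C" using Hom_Obj(2)[OF h(1)] .
    obtain k where k: "is_kernel C h k" using ex_kernel Hom_DomCod(3)[OF h(1)] by blast
    define K where "K = Dom C k"
    have kH: "k \<in> Hom C K I" using is_kernel_Hom[OF k h(1)] by (simp add: K_def)
    have km: "monic C k" and hk: "h \<cdot> k = Zero C K X"
      using k is_kernel_iff[OF h(1) kH] by auto
    obtain e' where e': "e' \<in> Hom C A K" "k \<cdot> e' = e"
      using k is_kernel_iff[OF h(1) kH] h(2) e(1) by blast
    have mk: "m \<cdot> k \<in> Hom C K B" "monic C (m \<cdot> k)"
      using Comp_Hom kH mH monic_comp km sesD(3)[OF m] by blast+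
    then obtain D t where t: "ses C K B D (m \<cdot> k) t" using ses_of_monic by blast
    note tH = sesD(2)[OF t]
    have D: "D \<in> Obj C" using Hom_Obj(2)[OF tH] .
    have "f = m \<cdot> k \<cdot> e'" using Comp_assoc[OF e'(1) kH mH] e' e by simp
    then have "t \<cdot> f = t \<cdot> (m \<cdot> k) \<cdot> e'" using Comp_assoc[OF e'(1) mk(1) tH] by simp
    then have "t \<cdot> f = Zero C A D" using sesD(5)[OF t] Comp_Zero_left[OF e'(1) D] by simp
    then obtain t' where t': "t' \<in> Hom C P D" "t' \<cdot> p = t"
      using p is_cokernel_iff[OF f pH] tH by blast
    have "t \<cdot> m = t' \<cdot> (p \<cdot> m)" using Comp_assoc[OF mH pH t'(1)] t'(2) by simp
    then have "t \<cdot> m = Zero C I D"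
      using sesD(5)[OF m] Comp_Zero_right[OF t'(1)] Hom_Obj(1)[OF mH] by simp
    then obtain w where w: "w \<in> Hom C I K" "m \<cdot> k \<cdot> w = m" using ses_lift[OF t mH] by blast
    have I: "I \<in> Obj C" using Hom_Obj(1)[OF mH] .
    have "m \<cdot> (k \<cdot> w) = m \<cdot> Id C I"
      using w Comp_assoc[OF w(1) kH mH] Comp_Id_right[OF mH] by simp
    then have kw: "k \<cdot> w = Id C I"
      using monic_cancel[OF sesD(3)[OF m] mH] Comp_Hom[OF w(1) kH] Id_Hom[OF I] by blast
    have "h = h \<cdot> k \<cdot> w" using Comp_assoc[OF w(1) kH h(1)] Comp_Id_right[OF h(1)] kw by simp
    then show ?thesis using hk Comp_Zero_left[OF w(1) X] by simp
  qed
  then have "epic C e" using epic_iff[OF e(1)] by blast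
  then show ?thesis using that e mH sesD(3)[OF m] by blast
qed

lemma iso_arrow_if_monic_epic:
  assumes f: "f \<in> Hom C A B" "monic C f" "epic C f"
  shows "iso_arrow C f"
proof -
  obtain D g where g: "ses C A B D f g" using ses_of_monic f(1,2) .
  have A: "A \<in> Obj C" and B: "B \<in> Obj C" using Hom_Obj[OF f(1)] by auto
  have "g = Zero C B D" using epicD[OF f(3,1) sesD(5)[OF g] sesD(2)[OF g]] .
  then have "g \<cdot> Id C B = Zero C B D" using Comp_Id_right sesD(2)[OF g] by simp
  \<comment> \<open>As \<open>g\<close> vanishes, the identity of \<open>B\<close> is killed by
    \<open>g\<close> and lifts through \<open>f\<close>, giving a right inverse.\<close>
  then obtain u where u: "u \<in> Hom C B A" "f \<cdot> u = Id C B"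
    using ses_lift[OF g Id_Hom[OF B]] by blast
  have "f \<cdot> (u \<cdot> f) = f \<cdot> Id C A"
    using u Comp_assoc[OF f(1) u(1) f(1)] Comp_Id_left[OF f(1)] Comp_Id_right[OF f(1)] by simp
  then have "u \<cdot> f = Id C A"
    using monic_cancel[OF f(2,1)] Comp_Hom[OF f(1) u(1)] Id_Hom[OF A] by blast
  then show ?thesis using u iso_arrow_iff[OF f(1)] by blast
qed

lemma iso_arrow_monic_epic:
  assumes f: "f \<in> Hom C A B" "iso_arrow C f"
  shows "monic C f" "epic C f"
proof -
  obtain g where g: "g \<in> Hom C B A" "g \<cdot> f = Id C A" "f \<cdot> g = Id C B"
    using f iso_arrow_iff by blast
  show "epic C f" using split_epic[OF f(1) g(1,3)] .
  show "monic C f"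
    using preadditive_category.split_epic[OF preadditive_category_opposite, of f B A g] f g by simp
qed

lemma ses_zero_right:
  assumes "ses C A B D f g" "zero_object C D"
  shows "iso_arrow C f"
proof -
  have "h = Zero C B X" if h: "h \<in> Hom C B X" "h \<cdot> f = Zero C A X" for X h
  proof -
    obtain u where u: "u \<in> Hom C D X" "u \<cdot> g = h" using ses_colift[OF assms(1) h] .
    have "u = Zero C D X" using zero_object_Hom(1)[OF assms(2) u(1)] .
    then show ?thesis using Comp_Zero_left[OF sesD(2)[OF assms(1)]] Hom_Obj(2)[OF h(1)] u(2) by simp
  qed
  then show ?thesis
    using epic_iff sesD(1,3)[OF assms(1)] iso_arrow_if_monic_epic by blast
qed

lemma ses_zero_left:
  assumes "ses C A B D f g" "zero_object C A"
  shows "iso_arrow C g"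
  using abelian_category.ses_zero_right[OF abelian_category_opposite, of D B A g f] assms by simp

text \<open>Read \<open>Q\<close> as \<open>M\<close> modulo \<open>S\<close> and \<open>N\<close>
  as \<open>Q\<close> modulo \<open>L\<close>. Then \<open>K\<close> is the preimage of
  \<open>L\<close> in \<open>M\<close>, it contains \<open>S\<close>, and the quotient of
  \<open>K\<close> by \<open>S\<close> is \<open>L\<close>.\<close>

lemma third_isomorphism:
  assumes p: "ses C S M Q i p" and g: "ses C L Q N k g" and \<kappa>: "ses C K M N \<kappa> (g \<cdot> p)"
  obtains s r where "\<kappa> \<cdot> s = i" "p \<cdot> \<kappa> = k \<cdot> r" "ses C S K L s r"
proof -
  note iH = sesD(1)[OF p] and pH = sesD(2)[OF p] and gH = sesD(2)[OF g]
  note k = sesD(1,3)[OF g] and \<kappa>H = sesD(1)[OF \<kappa>] and \<kappa>m = sesD(3)[OF \<kappa>]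
  have S: "S \<in> Obj C" using Hom_Obj(1)[OF iH] .
  have "g \<cdot> p \<cdot> i = Zero C S N"
    using Comp_assoc[OF iH pH gH] sesD(5)[OF p] Comp_Zero_right[OF gH S] by simp
  then obtain s where s: "s \<in> Hom C S K" "\<kappa> \<cdot> s = i" using ses_lift[OF \<kappa> iH] by blast
  have p\<kappa>: "p \<cdot> \<kappa> \<in> Hom C K Q" using Comp_Hom[OF \<kappa>H pH] .
  have "g \<cdot> (p \<cdot> \<kappa>) = Zero C K N" using Comp_assoc[OF \<kappa>H pH gH] sesD(5)[OF \<kappa>] by simp
  then obtain r where r: "r \<in> Hom C K L" "k \<cdot> r = p \<cdot> \<kappa>" using ses_lift[OF g p\<kappa>] by blast
  have sm: "monic C s" using monic_left_factor[OF _ s(1) \<kappa>H] s(2) sesD(3)[OF p] by simp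
  have "k \<cdot> (r \<cdot> s) = p \<cdot> i" using Comp_assoc[OF s(1) r(1) k(1)] Comp_assoc[OF s(1) \<kappa>H pH] r s by simp
  then have rs: "r \<cdot> s = Zero C S L"
    using monicD[OF k(2,1)] sesD(5)[OF p] Comp_Hom[OF s(1) r(1)] by simp
  have rk: "\<exists>u\<in>Hom C X S. s \<cdot> u = h" if h: "h \<in> Hom C X K" "r \<cdot> h = Zero C X L" for X h
  proof -
    have \<kappa>h: "\<kappa> \<cdot> h \<in> Hom C X M" using Comp_Hom[OF h(1) \<kappa>H] .
    have "p \<cdot> (\<kappa> \<cdot> h) = k \<cdot> (r \<cdot> h)"
      using Comp_assoc[OF h(1) \<kappa>H pH] Comp_assoc[OF h(1) r(1) k(1)] r(2) by simp
    then have "p \<cdot> (\<kappa> \<cdot> h) = Zero C X Q"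
      using h(2) Comp_Zero_right[OF k(1)] Hom_Obj(1)[OF h(1)] by simp
    then obtain u where u: "u \<in> Hom C X S" "i \<cdot> u = \<kappa> \<cdot> h" using ses_lift[OF p \<kappa>h] by blast
    have "\<kappa> \<cdot> (s \<cdot> u) = \<kappa> \<cdot> h" using Comp_assoc[OF u(1) s(1) \<kappa>H] s(2) u(2) by simp
    then show ?thesis using monic_cancel[OF \<kappa>m \<kappa>H] Comp_Hom[OF u(1) s(1)] h(1) u(1) by blast
  qed
  have ker: "is_kernel C r s" using is_kernel_iff[OF r(1) s(1)] sm rs rk by blast
  \<comment> \<open>Let \<open>I\<close> be the image of \<open>r\<close> and \<open>c\<close> the
    cokernel of its inclusion into \<open>Q\<close>. Since \<open>c \<cdot> p\<close> kills
    \<open>K\<close>, it factors through \<open>g \<cdot> p\<close>, so \<open>c\<close> kills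
    \<open>L\<close>. Thus \<open>L\<close> lies inside \<open>I\<close> and \<open>m\<close> is
    split epic.\<close>
  have "epic C r"
  proof -
    obtain I e m where em: "e \<in> Hom C K I" "epic C e" "m \<in> Hom C I L" "monic C m" "m \<cdot> e = r"
      using image_factorisation[OF r(1)] .
    have km: "k \<cdot> m \<in> Hom C I Q" "monic C (k \<cdot> m)"
      using Comp_Hom[OF em(3) k(1)] monic_comp[OF em(4,3) k(2,1)] .
    then obtain Y c where c: "ses C I Q Y (k \<cdot> m) c" using ses_of_monic by blast
    note cH = sesD(2)[OF c]
    have Y: "Y \<in> Obj C" using Hom_Obj(2)[OF cH] .
    have "p \<cdot> \<kappa> = k \<cdot> m \<cdot> e" using r(2) em(5) Comp_assoc[OF em(1,3) k(1)] by simp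
    then have "c \<cdot> p \<cdot> \<kappa> = c \<cdot> (k \<cdot> m) \<cdot> e"
      using Comp_assoc[OF \<kappa>H pH cH] Comp_assoc[OF em(1) km(1) cH] by simp
    also have "\<dots> = Zero C K Y" using sesD(5)[OF c] Comp_Zero_left[OF em(1) Y] by simp
    finally obtain t where t: "t \<in> Hom C N Y" "t \<cdot> (g \<cdot> p) = c \<cdot> p"
      using ses_colift[OF \<kappa> Comp_Hom[OF pH cH]] by blast
    then have "t \<cdot> g \<cdot> p = c \<cdot> p" using Comp_assoc[OF pH gH t(1)] by simp
    then have "t \<cdot> g = c" using epic_cancel[OF sesD(4)[OF p] pH] Comp_Hom[OF gH t(1)] cH by blast
    then have "c \<cdot> k = t \<cdot> (g \<cdot> k)" using Comp_assoc[OF k(1) gH t(1)] by simp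
    also have "\<dots> = Zero C L Y"
      using sesD(5)[OF g] Comp_Zero_right[OF t(1)] Hom_Obj(1)[OF k(1)] by simp
    finally obtain w where w: "w \<in> Hom C L I" "k \<cdot> m \<cdot> w = k" using ses_lift[OF c k(1)] by blast
    have "k \<cdot> (m \<cdot> w) = k \<cdot> Id C L"
      using w Comp_assoc[OF w(1) em(3) k(1)] Comp_Id_right[OF k(1)] by simp
    then have "m \<cdot> w = Id C L"
      using monic_cancel[OF k(2,1)] Comp_Hom[OF w(1) em(3)] Id_Hom Hom_Obj(1)[OF k(1)] by blast
    then have "epic C m" using split_epic[OF em(3) w(1)] by blast
    then show ?thesis using epic_comp[OF em(2,1) _ em(3)] em(5) by simp
  qed
  then have r_ses: "ses C S K L s r" using ses_epicI[OF s(1) r(1)] ker by blast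
  then show ?thesis using that[OF s(2) r(2)[symmetric]] by blast
qed

text \<open>The preimage of the subobject \<open>L\<close> of \<open>Q\<close> is constructed as the
  kernel of \<open>g \<cdot> p\<close>, where \<open>g\<close> is a cokernel of \<open>k\<close>.
  The last two conclusions are its lifting property as a pullback and the identification of the
  quotient of \<open>M\<close> by \<open>K\<close> with that of \<open>Q\<close> by
  \<open>L\<close>.\<close>

lemma preimage:
  assumes p: "ses C S M Q i p" and k: "k \<in> Hom C L Q" "monic C k"
  obtains K \<kappa> s r where "\<kappa> \<in> Hom C K M" "monic C \<kappa>" "\<kappa> \<cdot> s = i" "p \<cdot> \<kappa> = k \<cdot> r"
    "ses C S K L s r"
    "\<And>X h u. \<lbrakk>h \<in> Hom C X M; u \<in> Hom C X L; p \<cdot> h = k \<cdot> u\<rbrakk> \<Longrightarrow> \<exists>v \<in> Hom C X K. \<kappa> \<cdot> v = h"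
    "\<And>N g. ses C L Q N k g \<Longrightarrow> ses C K M N \<kappa> (g \<cdot> p)"
proof -
  note pH = sesD(2)[OF p]
  have comp0: "g \<cdot> p \<cdot> h = Zero C X N"
    if "ses C L Q N k g" "h \<in> Hom C X M" "u \<in> Hom C X L" "p \<cdot> h = k \<cdot> u" for N g X h u
  proof -
    note gH = sesD(2)[OF that(1)]
    have "g \<cdot> p \<cdot> h = g \<cdot> (k \<cdot> u)" using Comp_assoc[OF that(2) pH gH] that(4) by simp
    also have "\<dots> = g \<cdot> k \<cdot> u" using Comp_assoc[OF that(3) k(1) gH] by simp
    also have "\<dots> = Zero C X N"
      using sesD(5)[OF that(1)] Comp_Zero_left[OF that(3) Hom_Obj(2)[OF gH]] by simp
    finally show ?thesis .
  qed
  obtain N g where g: "ses C L Q N k g" using ses_of_monic k .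
  note gH = sesD(2)[OF g]
  have "g \<cdot> p \<in> Hom C M N" "epic C (g \<cdot> p)"
    using Comp_Hom[OF pH gH] epic_comp[OF _ pH _ gH] sesD(4)[OF g] sesD(4)[OF p] by blast+
  then obtain K \<kappa> where \<kappa>: "ses C K M N \<kappa> (g \<cdot> p)" using ses_of_epic by blast
  note \<kappa>H = sesD(1)[OF \<kappa>] and \<kappa>m = sesD(3)[OF \<kappa>]
  obtain s r where s: "\<kappa> \<cdot> s = i" and r: "p \<cdot> \<kappa> = k \<cdot> r" and sr: "ses C S K L s r"
    using third_isomorphism[OF p g \<kappa>] .
  have univ: "\<exists>v \<in> Hom C X K. \<kappa> \<cdot> v = h"
    if h: "h \<in> Hom C X M" "u \<in> Hom C X L" "p \<cdot> h = k \<cdot> u" for X h u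
    using ses_lift[OF \<kappa> h(1)] comp0[OF g h] by blast
  \<comment> \<open>The construction used one cokernel \<open>g\<close> of \<open>k\<close>. For any
    other one, an arrow killed by \<open>g' \<cdot> p\<close> is sent by \<open>p\<close> into
    \<open>L\<close>, so the lifting property shows that \<open>\<kappa>\<close> is again the
    kernel.\<close>
  have "ses C K M N' \<kappa> (g' \<cdot> p)" if g': "ses C L Q N' k g'" for N' g'
  proof -
    note g'H = sesD(2)[OF g']
    have g'p: "g' \<cdot> p \<in> Hom C M N'" "epic C (g' \<cdot> p)"
      using Comp_Hom[OF pH g'H] epic_comp[OF _ pH _ g'H] sesD(4)[OF g'] sesD(4)[OF p] by blast+
    have "\<exists>v\<in>Hom C X K. \<kappa> \<cdot> v = h" if h: "h \<in> Hom C X M" "g' \<cdot> p \<cdot> h = Zero C X N'" for X h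
    proof -
      have "g' \<cdot> (p \<cdot> h) = Zero C X N'" using Comp_assoc[OF h(1) pH g'H] h(2) by simp
      then obtain u where "u \<in> Hom C X L" "k \<cdot> u = p \<cdot> h"
        using ses_lift[OF g' Comp_Hom[OF h(1) pH]] by blast
      then show ?thesis using univ[OF h(1)] by simp
    qed
    then have "is_kernel C (g' \<cdot> p) \<kappa>"
      using is_kernel_iff[OF g'p(1) \<kappa>H] \<kappa>m comp0[OF g' \<kappa>H sesD(2)[OF sr] r] by simp
    then show ?thesis using ses_epicI[OF \<kappa>H g'p] by blast
  qed
  then show ?thesis using that[OF \<kappa>H \<kappa>m s r sr] univ by blast
qed

end

section \<open>Length\<close>

definition has_length :: "('o, 'a, 'x) precategory_scheme \<Rightarrow> 'o \<Rightarrow> nat \<Rightarrow> bool" where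
  "has_length C A n \<longleftrightarrow> (\<exists>X i. composition_series C A n X i)"

text \<open>The minimum makes length a function before different composition series are compared;
  its value is unspecified where no series exists.\<close>

definition len :: "('o, 'a, 'x) precategory_scheme \<Rightarrow> 'o \<Rightarrow> nat" where
  "len C A = (LEAST n. has_length C A n)"

lemma has_length_0: "has_length C A 0 \<longleftrightarrow> zero_object C A"
  by (auto simp: has_length_def composition_series_def)

context abelian_category
begin

text \<open>Recursive form of a composition series, by cutting off the top simple factor; it also
  makes series in \<open>C\<close> comparable with those in \<open>opposite C\<close>.\<close>

lemma has_length_Suc:
  "has_length C A (Suc n) \<longleftrightarrow>
    (\<exists>X S x q. has_length C X n \<and> ses C X A S x q \<and> simple_object C S)"
proof
  assume "has_length C A (Suc n)"
  then obtain X i where c: "composition_series C A (Suc n) X i" by (auto simp: has_length_def)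
  then have i: "i n \<in> Hom C (X n) A" "monic C (i n)"
    by (auto simp: composition_series_def)
  obtain p where p: "is_cokernel C (i n) p" "simple_object C (Cod C p)"
    using c by (auto simp: composition_series_def)
  have "ses C (X n) A (Cod C p) (i n) p"
    using ses_monicI[OF i is_cokernel_Hom[OF p(1) i(1)] p(1)] .
  moreover have "composition_series C (X n) n X i"
    using c by (auto simp: composition_series_def)
  then have "has_length C (X n) n" unfolding has_length_def by blast
  ultimately show "\<exists>X S x q. has_length C X n \<and> ses C X A S x q \<and> simple_object C S"
    using p(2) by blast
next
  assume "\<exists>X S x q. has_length C X n \<and> ses C X A S x q \<and> simple_object C S"
  then obtain X S x q Y i where s: "ses C X A S x q" "simple_object C S"
    and c: "composition_series C X n Y i" by (auto simp: has_length_def)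
  have "Cod C q = S" using Hom_DomCod(2)[OF sesD(2)[OF s(1)]] .
  then have "composition_series C A (Suc n) (Y(Suc n := A)) (i(n := x))"
    using c s(2) sesD(1,3,7)[OF s(1)]
    by (auto simp: composition_series_def less_Suc_eq)
  then show "has_length C A (Suc n)" by (auto simp: has_length_def)
qed

text \<open>Let \<open>X\<close> be the last proper term of a series of \<open>B\<close>, with
  simple quotient \<open>S\<close>. The image of \<open>A\<close> in \<open>S\<close> is zero or
  everything, so \<open>S\<close> becomes the top factor of a series of \<open>D\<close> or of
  \<open>A\<close>, and the induction hypothesis is applied to a sequence with middle term
  \<open>X\<close>.\<close>

lemma has_length_ses:
  assumes "has_length C B n" "ses C A B D f g"
  shows "\<exists>a d. a + d \<le> n \<and> has_length C A a \<and> has_length C D d"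
  using assms
proof (induction n arbitrary: A B D f g)
  case 0
  then have z: "zero_object C B" by (simp add: has_length_0)
  note f = sesD[OF "0.prems"(2)]
  have "zero_object C A" using monic_zero_object[OF f(3,1) zero_object_Hom(2)[OF z f(1)]] .
  moreover have "zero_object C D" using epic_zero_object[OF f(4,2) zero_object_Hom(1)[OF z f(2)]] .
  ultimately show ?case by (auto simp: has_length_0[symmetric])
next
  case (Suc n)
  note f = sesD[OF Suc.prems(2)]
  obtain X S x q where X: "has_length C X n" and x: "ses C X B S x q" and S: "simple_object C S"
    using Suc.prems(1) by (auto simp: has_length_Suc)
  note x' = sesD[OF x]
  have qf: "q \<cdot> f \<in> Hom C A S" using Comp_Hom[OF f(1) x'(2)] .
  show ?case
  proof (cases "q \<cdot> f = Zero C A S")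
    \<comment> \<open>Here \<open>A\<close> lies inside \<open>X\<close>, so \<open>S\<close> is a
      quotient of \<open>D\<close>; its kernel \<open>L\<close> is \<open>X\<close> modulo
      \<open>A\<close>.\<close>
    case True
    obtain g' where g': "g' \<in> Hom C D S" "g' \<cdot> g = q"
      using ses_colift[OF Suc.prems(2) x'(2) True] .
    have "epic C g'" using epic_right_factor[OF _ f(2) g'(1)] g'(2) x'(4) by simp
    then obtain L l where l: "ses C L D S l g'" using ses_of_epic g'(1) by blast
    obtain s r where "ses C A X L s r"
      using third_isomorphism[OF Suc.prems(2) l, of X x] x g'(2) by blast
    then obtain a d where "a + d \<le> n" "has_length C A a" "has_length C L d"
      using Suc.IH[OF X] by blast
    then show ?thesis using l S has_length_Suc[of D d] by (intro exI[of _ a] exI[of _ "Suc d"]) auto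
  next
    \<comment> \<open>Here \<open>A\<close> maps onto the simple object \<open>S\<close>. The kernel
      \<open>K\<close> is the intersection of \<open>A\<close> with \<open>X\<close>, and
      \<open>X\<close> modulo \<open>K\<close> is all of \<open>D\<close>.\<close>
    case False
    obtain I e m where em: "e \<in> Hom C A I" "epic C e" "m \<in> Hom C I S" "monic C m" "m \<cdot> e = q \<cdot> f"
      using image_factorisation[OF qf] .
    have "\<not> zero_object C I"
    proof
      assume "zero_object C I"
      then have "m = Zero C I S" using zero_object_Hom(1) em(3) by blast
      then show False using False em(5) Comp_Zero_left[OF em(1) Hom_Obj(2)[OF qf]] by simp
    qed
    then have "iso_arrow C m" using S em(3,4) by (auto simp: simple_object_def Hom_def)
    then have qf_epic: "epic C (q \<cdot> f)"
      using em(5) epic_comp[OF em(2,1) _ em(3)] iso_arrow_monic_epic(2)[OF em(3)] by simp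
    then obtain K j where j: "ses C K A S j (q \<cdot> f)" using ses_of_epic qf by blast
    note j' = sesD[OF j]
    have fj: "f \<cdot> j \<in> Hom C K B" "monic C (f \<cdot> j)"
      using Comp_Hom[OF j'(1) f(1)] monic_comp[OF j'(3,1) f(3,1)] .
    have "q \<cdot> (f \<cdot> j) = Zero C K S" using Comp_assoc[OF j'(1) f(1) x'(2)] j'(5) by simp
    then obtain t where t: "t \<in> Hom C K X" "x \<cdot> t = f \<cdot> j" using ses_lift[OF x fj(1)] by blast
    have gx: "g \<cdot> x \<in> Hom C X D" using Comp_Hom[OF x'(1) f(2)] .
    have t_monic: "monic C t" using monic_left_factor[OF _ t(1) x'(1)] t(2) fj(2) by simp
    have "g \<cdot> x \<cdot> t = g \<cdot> f \<cdot> j"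
      using Comp_assoc[OF t(1) x'(1) f(2)] Comp_assoc[OF j'(1) f(1) f(2)] t(2) by simp
    then have gxt: "g \<cdot> x \<cdot> t = Zero C K D"
      using f(5) Comp_Zero_left[OF j'(1) f(10)] by simp
    \<comment> \<open>An arrow to \<open>X\<close> killed on the way to \<open>D\<close> lifts to
      \<open>A\<close>; as it comes from \<open>X\<close>, it dies in \<open>S\<close> and so lifts
      further to \<open>K\<close>.\<close>
    have "\<exists>u\<in>Hom C Y K. t \<cdot> u = h" if h: "h \<in> Hom C Y X" "g \<cdot> x \<cdot> h = Zero C Y D" for Y h
    proof -
      have xh: "x \<cdot> h \<in> Hom C Y B" using Comp_Hom[OF h(1) x'(1)] .
      have "g \<cdot> (x \<cdot> h) = Zero C Y D" using Comp_assoc[OF h(1) x'(1) f(2)] h(2) by simp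
      then obtain u where u: "u \<in> Hom C Y A" "f \<cdot> u = x \<cdot> h"
        using ses_lift[OF Suc.prems(2) xh] by blast
      have "q \<cdot> f \<cdot> u = q \<cdot> x \<cdot> h"
        using Comp_assoc[OF u(1) f(1) x'(2)] Comp_assoc[OF h(1) x'(1) x'(2)] u(2) by simp
      then have "q \<cdot> f \<cdot> u = Zero C Y S" using x'(5) Comp_Zero_left[OF h(1) x'(10)] by simp
      then obtain v where v: "v \<in> Hom C Y K" "j \<cdot> v = u" using ses_lift[OF j u(1)] by blast
      have "x \<cdot> (t \<cdot> v) = f \<cdot> j \<cdot> v" using Comp_assoc[OF v(1) t(1) x'(1)] t(2) by simp
      also have "\<dots> = x \<cdot> h" using Comp_assoc[OF v(1) j'(1) f(1)] v(2) u(2) by simp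
      finally have "t \<cdot> v = h" using monic_cancel[OF x'(3,1)] Comp_Hom[OF v(1) t(1)] h(1) by blast
      then show ?thesis using v(1) by blast
    qed
    then have ker: "is_kernel C (g \<cdot> x) t" using is_kernel_iff[OF gx t(1)] t_monic gxt by blast
    \<comment> \<open>If \<open>h\<close> kills the image of \<open>X\<close> in \<open>D\<close>,
      then \<open>h \<cdot> g\<close> factors through \<open>S\<close>. It also vanishes on
      \<open>A\<close>, which maps onto \<open>S\<close>, so the factor \<open>w\<close> is
      zero.\<close>
    have "h = Zero C D Y" if h: "h \<in> Hom C D Y" "h \<cdot> (g \<cdot> x) = Zero C X Y" for Y h
    proof -
      have Y: "Y \<in> Obj C" using Hom_Obj(2)[OF h(1)] .
      have hg: "h \<cdot> g \<in> Hom C B Y" using Comp_Hom[OF f(2) h(1)] .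
      have "h \<cdot> g \<cdot> x = Zero C X Y" using Comp_assoc[OF x'(1) f(2) h(1)] h(2) by simp
      then obtain w where w: "w \<in> Hom C S Y" "w \<cdot> q = h \<cdot> g" using ses_colift[OF x hg] by blast
      have "w \<cdot> (q \<cdot> f) = h \<cdot> (g \<cdot> f)"
        using Comp_assoc[OF f(1) x'(2) w(1)] Comp_assoc[OF f(1) f(2) h(1)] w(2) by simp
      then have "w \<cdot> (q \<cdot> f) = Zero C A Y" using f(5) Comp_Zero_right[OF h(1) f(8)] by simp
      then have "w = Zero C S Y" using epicD[OF qf_epic qf _ w(1)] by blast
      then have "h \<cdot> g = Zero C B Y" using w(2) Comp_Zero_left[OF x'(2) Y] by simp
      then show ?thesis using epicD[OF f(4,2) _ h(1)] by blast
    qed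
    then have "epic C (g \<cdot> x)" using epic_iff[OF gx] by blast
    then have "ses C K X D t (g \<cdot> x)" using ses_epicI[OF t(1) gx _ ker] by blast
    then obtain a d where "a + d \<le> n" "has_length C K a" "has_length C D d"
      using Suc.IH[OF X] by blast
    then show ?thesis using j S has_length_Suc[of A a] by (intro exI[of _ "Suc a"] exI[of _ d]) auto
  qed
qed

section \<open>Finite length in the opposite category\<close>

lemma simple_object_opposite:
  assumes "simple_object C S"
  shows "simple_object (opposite C) S"
proof -
  \<comment> \<open>Simplicity is defined through subobjects; for a quotient it is applied to the
    kernel, which is zero or everything.\<close>
  have "zero_object C (Cod C p) \<or> iso_arrow C p" if p: "epic C p" "Dom C p = S" for p
  proof -
    have pH: "p \<in> Hom C S (Cod C p)" using p by (auto simp: epic_def Hom_def)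
    obtain K k where k: "ses C K S (Cod C p) k p" using ses_of_epic[OF pH p(1)] .
    have "zero_object C K \<or> iso_arrow C k"
      using assms sesD(1,3)[OF k] by (auto simp: simple_object_def Hom_def)
    then show ?thesis
    proof
      assume "zero_object C K"
      then show ?thesis using ses_zero_left[OF k] by blast
    next
      assume "iso_arrow C k"
      then have "epic C k" using iso_arrow_monic_epic(2) sesD(1)[OF k] by blast
      then have "p = Zero C S (Cod C p)" using epicD sesD(1,2,5)[OF k] by blast
      then show ?thesis using epic_zero_object[OF p(1) pH] by blast
    qed
  qed
  then show ?thesis using assms by (simp add: simple_object_def)
qed

text \<open>A series in the opposite category removes simple subobjects from the bottom. This lemma
  adds a simple factor at the top of such a series, which is the step needed to turn a series
  around.\<close>

lemma has_length_opposite_ses: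
  assumes "has_length (opposite C) Y m" "ses C Y A S f g" "simple_object C S"
  shows "\<exists>m'. has_length (opposite C) A m'"
  using assms
proof (induction m arbitrary: Y A f g)
  case 0
  interpret O: abelian_category "opposite C" by (rule abelian_category_opposite)
  note f = sesD[OF "0.prems"(2)]
  \<comment> \<open>With \<open>Y\<close> zero, \<open>A\<close> is isomorphic to \<open>S\<close>,
    so \<open>S\<close> serves as a simple subobject of \<open>A\<close> with zero quotient.\<close>
  have "iso_arrow C g" using ses_zero_left[OF "0.prems"(2)] "0.prems"(1) by (simp add: has_length_0)
  then obtain h where h: "h \<in> Hom C S A" "h \<cdot> g = Id C A" "g \<cdot> h = Id C S"
    using iso_arrow_iff[OF f(2)] by blast
  have "iso_arrow C h" using iso_arrow_iff[OF h(1)] h f(2) by blast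
  then have me: "monic C h" "epic C h" using iso_arrow_monic_epic[OF h(1)] by blast+
  obtain D c where c: "ses C S A D h c" using ses_of_monic[OF h(1) me(1)] .
  have "c = Zero C A D" using epicD[OF me(2) h(1) sesD(5,2)[OF c]] .
  then have "zero_object C D" using epic_zero_object sesD(4,2)[OF c] by blast
  then have "has_length (opposite C) D 0" by (simp add: has_length_0)
  moreover have "ses (opposite C) D A S c h" using c by simp
  ultimately show ?case
    using O.has_length_Suc[of A 0] simple_object_opposite[OF "0.prems"(3)] by blast
next
  case (Suc m)
  interpret O: abelian_category "opposite C" by (rule abelian_category_opposite)
  note f = sesD[OF Suc.prems(2)]
  obtain Y' K y k where Y': "has_length (opposite C) Y' m" and k: "ses C K Y Y' k y"
    and K: "simple_object (opposite C) K"
    using Suc.prems(1) by (auto simp: O.has_length_Suc)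
  note k' = sesD[OF k]
  \<comment> \<open>The bottom factor \<open>K\<close> of \<open>Y\<close> is divided out of both
    \<open>Y\<close> and \<open>A\<close>. By the third isomorphism theorem, read in the opposite
    category, the quotient \<open>S\<close> is unchanged.\<close>
  obtain A' a where a: "ses C K A A' (f \<cdot> k) a"
    using ses_of_monic[OF Comp_Hom[OF k'(1) f(1)] monic_comp[OF k'(3,1) f(3,1)]] .
  obtain s r where "ses C Y' A' S r s"
    using O.third_isomorphism[of S A Y g f Y' K y k A' a] Suc.prems(2) k a by simp blast
  then obtain m' where "has_length (opposite C) A' m'"
    using Suc.IH[OF Y' _ Suc.prems(3)] by blast
  moreover have "ses (opposite C) A' A K a (f \<cdot> k)" using a by simp
  ultimately show ?case using O.has_length_Suc K by blast
qed

lemma has_length_opposite: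
  "has_length C A n \<Longrightarrow> \<exists>m. has_length (opposite C) A m"
proof (induction n arbitrary: A)
  case 0
  then show ?case by (metis has_length_0 zero_object_opposite)
next
  case (Suc n)
  then show ?case using has_length_Suc has_length_opposite_ses by metis
qed

end

context abelian_length_category
begin

lemma has_length_len: "A \<in> Obj C \<Longrightarrow> has_length C A (len C A)"
  unfolding len_def using ex_composition_series LeastI_ex[of "has_length C A"]
  by (auto simp: has_length_def)

lemma len_ses:
  assumes "ses C A B D f g"
  shows "len C A + len C D \<le> len C B"
proof -
  obtain a d where "a + d \<le> len C B" "has_length C A a" "has_length C D d"
    using has_length_ses[OF has_length_len assms] sesD(9)[OF assms] by blast
  moreover have "len C A \<le> a" "len C D \<le> d"
    unfolding len_def by (rule Least_le, fact)+
  ultimately show ?thesis by linarith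
qed

lemma len_pos: "\<lbrakk>A \<in> Obj C; \<not> zero_object C A\<rbrakk> \<Longrightarrow> 0 < len C A"
  using has_length_len[of A] has_length_0[of C A] by (cases "len C A") auto

lemma len_ses_less:
  assumes "ses C A B D f g"
  shows "\<not> zero_object C A \<Longrightarrow> len C D < len C B" "\<not> zero_object C D \<Longrightarrow> len C A < len C B"
  using len_ses[OF assms] len_pos sesD(8,10)[OF assms] by fastforce+

lemma abelian_length_category_opposite: "abelian_length_category (opposite C)"
proof -
  interpret O: abelian_category "opposite C" by (rule abelian_category_opposite)
  show ?thesis
  proof
    fix A assume "A \<in> Obj (opposite C)"
    then show "\<exists>n X i. composition_series (opposite C) A n X i"
      using has_length_opposite[OF has_length_len[of A]] by (auto simp: has_length_def)
  qed
qed

end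

section \<open>Torsion classes and perpendicular categories\<close>

text \<open>Together with \<open>right_perp\<close> this forms a Galois connection;
  \<open>left_perp C (right_perp C X)\<close> will be the torsion class generated by a set of
  objects \<open>X\<close>.\<close>

definition left_perp :: "('o, 'a, 'x) precategory_scheme \<Rightarrow> 'o set \<Rightarrow> 'o set" where
  "left_perp C Y = {X \<in> Obj C. \<forall>B\<in>Y. Hom C X B = {Zero C X B}}"

lemma left_perp_opposite [simp]: "left_perp (opposite C) = right_perp C"
  by (simp add: left_perp_def right_perp_def fun_eq_iff)

lemma right_perp_opposite [simp]: "right_perp (opposite C) = left_perp C"
  by (simp add: left_perp_def right_perp_def fun_eq_iff)

section \<open>Torsion and torsion-free classes\<close>

context abelian_category
begin

lemma right_perp_iff:
  assumes "X \<subseteq> Obj C"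
  shows "Y \<in> right_perp C X \<longleftrightarrow> Y \<in> Obj C \<and> (\<forall>A\<in>X. \<forall>f\<in>Hom C A Y. f = Zero C A Y)"
  using assms Zero_Hom unfolding right_perp_def by blast

lemma left_perp_iff:
  assumes "Y \<subseteq> Obj C"
  shows "X \<in> left_perp C Y \<longleftrightarrow> X \<in> Obj C \<and> (\<forall>B\<in>Y. \<forall>f\<in>Hom C X B. f = Zero C X B)"
  using assms Zero_Hom unfolding left_perp_def by blast

lemma perp_Obj: "right_perp C X \<subseteq> Obj C" "left_perp C X \<subseteq> Obj C"
  by (auto simp: right_perp_def left_perp_def)

lemma torsD:
  assumes "T \<in> tors C"
  shows tors_Obj: "T \<subseteq> Obj C"
    and tors_ext: "\<lbrakk>ses C A B D f g; A \<in> T; D \<in> T\<rbrakk> \<Longrightarrow> B \<in> T"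
    and tors_factor: "\<lbrakk>p \<in> Hom C A B; epic C p; A \<in> T\<rbrakk> \<Longrightarrow> B \<in> T"
  using assms
  by (auto simp: tors_def torsion_class_def subcategory_def closed_extensions_def
      closed_factors_def ses_def Hom_def)

lemma zero_object_in_tors:
  assumes "T \<in> tors C" "zero_object C Z"
  shows "Z \<in> T"
proof -
  obtain A where A: "A \<in> T" "A \<in> Obj C"
    using assms(1) by (auto simp: tors_def torsion_class_def subcategory_def)
  have Z: "Z \<in> Obj C" using assms(2) by (simp add: zero_object_def)
  have "h = Zero C Z X" if "h \<in> Hom C Z X" for X h
    using zero_object_Hom(1)[OF assms(2) that] .
  then have "epic C (Zero C A Z)" using epic_iff[OF Zero_Hom[OF A(2) Z]] by blast
  then show ?thesis using tors_factor[OF assms(1) Zero_Hom[OF A(2) Z]] A(1) by blast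
qed

lemma closed_factors_iso:
  assumes "closed_factors C T" "A \<in> T" "isomorphic C A B"
  shows "B \<in> T"
  using assms iso_arrow_monic_epic(2) unfolding closed_factors_def isomorphic_def
  by (metis Hom_DomCod(1,2))

lemma left_perp_tors:
  assumes Y: "Y \<subseteq> Obj C"
  shows "left_perp C Y \<in> tors C"
proof -
  obtain Z where Z: "zero_object C Z" using ex_zero_object by blast
  have "Z \<in> left_perp C Y"
    using Z zero_object_Hom(1)[OF Z] left_perp_iff[OF Y] by (auto simp: zero_object_def)
  then have ne: "left_perp C Y \<noteq> {}" by blast
  have "B \<in> left_perp C Y" if p: "epic C p" "p \<in> Hom C A B" "A \<in> left_perp C Y" for p A B
  proof -
    have "h = Zero C B N" if h: "N \<in> Y" "h \<in> Hom C B N" for N h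
    proof -
      have "h \<cdot> p = Zero C A N"
        using p(3) left_perp_iff[OF Y] h(1) Comp_Hom[OF p(2) h(2)] by blast
      then show ?thesis using epicD[OF p(1,2) _ h(2)] by blast
    qed
    then show ?thesis using left_perp_iff[OF Y] Hom_Obj(2)[OF p(2)] by blast
  qed
  then have fac: "closed_factors C (left_perp C Y)"
    unfolding closed_factors_def by (auto simp: epic_def Hom_def)
  have "B \<in> left_perp C Y" if s: "ses C A B D f g" "A \<in> left_perp C Y" "D \<in> left_perp C Y"
    for A B D f g
  proof -
    have "h = Zero C B N" if h: "N \<in> Y" "h \<in> Hom C B N" for N h
    proof -
      have "h \<cdot> f = Zero C A N"
        using s(2) left_perp_iff[OF Y] h(1) Comp_Hom[OF sesD(1)[OF s(1)] h(2)] by blast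
      then obtain u where u: "u \<in> Hom C D N" "u \<cdot> g = h" using ses_colift[OF s(1) h(2)] by blast
      have "u = Zero C D N" using s(3) left_perp_iff[OF Y] h(1) u(1) by blast
      then show ?thesis
        using u(2) Comp_Zero_left[OF sesD(2)[OF s(1)]] Hom_Obj(2)[OF h(2)] by simp
    qed
    then show ?thesis using left_perp_iff[OF Y] sesD(9)[OF s(1)] by blast
  qed
  then have ext: "closed_extensions C (left_perp C Y)"
    unfolding closed_extensions_def ses_def short_exact_def
    by (metis (no_types, lifting) Hom_DomCod(1) HomI is_cokernel_def)
  have "subcategory C (left_perp C Y)"
    using ne perp_Obj(2) closed_factors_iso[OF fac] unfolding subcategory_def by blast
  then show ?thesis using fac ext by (simp add: tors_def torsion_class_def)
qed

text \<open>Torsion-free classes are treated as torsion classes of the opposite category, so their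
  closure under extensions, subobjects and zero objects is read off by duality.\<close>

lemma right_perp_tors:
  assumes "X \<subseteq> Obj C"
  shows "right_perp C X \<in> tors (opposite C)"
  using abelian_category.left_perp_tors[OF abelian_category_opposite, of X] assms by simp

lemma right_perp_ext:
  assumes "X \<subseteq> Obj C" "ses C A B D f g" "A \<in> right_perp C X" "D \<in> right_perp C X"
  shows "B \<in> right_perp C X"
  using abelian_category.tors_ext[OF abelian_category_opposite right_perp_tors[OF assms(1)],
      of D B A g f] assms by simp

lemma right_perp_sub:
  assumes "X \<subseteq> Obj C" "m \<in> Hom C A B" "monic C m" "B \<in> right_perp C X"
  shows "A \<in> right_perp C X"
  using abelian_category.tors_factor[OF abelian_category_opposite right_perp_tors[OF assms(1)],
      of m B A] assms by simp

lemma right_perp_zero: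
  assumes "X \<subseteq> Obj C" "zero_object C Z"
  shows "Z \<in> right_perp C X"
  using abelian_category.zero_object_in_tors[OF abelian_category_opposite right_perp_tors[OF assms(1)],
      of Z] assms by simp

lemma right_perp_antimono: "X \<subseteq> Y \<Longrightarrow> right_perp C Y \<subseteq> right_perp C X"
  by (auto simp: right_perp_def)

lemma left_perp_antimono: "X \<subseteq> Y \<Longrightarrow> left_perp C Y \<subseteq> left_perp C X"
  by (auto simp: left_perp_def)

lemma subset_left_right_perp: "X \<subseteq> Obj C \<Longrightarrow> X \<subseteq> left_perp C (right_perp C X)"
  by (auto simp: left_perp_def right_perp_def)

lemma perp_inter_zero:
  assumes "X \<subseteq> Obj C" "A \<in> X" "A \<in> right_perp C X"
  shows "zero_object C A"
  using assms right_perp_iff[OF assms(1), of A] Id_Hom[of A] zero_object_iff[of A] by blast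

text \<open>Otherwise \<open>M\<close> would lie in \<open>right_perp C \<X>\<close> as well as in
  the left perpendicular of that class, and its identity would vanish.\<close>

lemma nonzero_Hom:
  assumes "\<X> \<subseteq> Obj C" "M \<in> left_perp C (right_perp C \<X>)" "\<not> zero_object C M"
  obtains A f where "A \<in> \<X>" "f \<in> Hom C A M" "f \<noteq> Zero C A M"
proof -
  have M: "M \<in> Obj C" using assms(2) perp_Obj by blast
  have "M \<notin> right_perp C \<X>"
  proof
    assume "M \<in> right_perp C \<X>"
    then have "Id C M = Zero C M M"
      using assms(2) left_perp_iff[OF perp_Obj(1)] Id_Hom[OF M] by blast
    then show False using assms(3) M zero_object_iff by blast
  qed
  then show ?thesis using that right_perp_iff[OF assms(1)] M by blast
qed

lemma nonzero_image:
  assumes "f \<in> Hom C A B" "f \<noteq> Zero C A B"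
  obtains I e m where "e \<in> Hom C A I" "epic C e" "m \<in> Hom C I B" "monic C m" "m \<cdot> e = f"
    "\<not> zero_object C I"
proof -
  obtain I e m where em: "e \<in> Hom C A I" "epic C e" "m \<in> Hom C I B" "monic C m" "m \<cdot> e = f"
    using image_factorisation[OF assms(1)] .
  have "\<not> zero_object C I"
  proof
    assume "zero_object C I"
    then have "m = Zero C I B" using zero_object_Hom(1) em(3) by blast
    then show False using assms em(5) Comp_Zero_left[OF em(1) Hom_Obj(2)[OF assms(1)]] by simp
  qed
  then show ?thesis using that em by blast
qed

end

section \<open>Torsion pairs in a length category\<close>

context abelian_length_category
begin

text \<open>Induction on length. If \<open>M\<close> is not torsion-free, the image \<open>I\<close>
  of a nonzero arrow from \<open>T\<close> is a nonzero torsion subobject. The torsion part of the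
  shorter quotient \<open>Q\<close>, pulled back to \<open>M\<close>, is an extension of torsion
  objects.\<close>

lemma torsion_sequence:
  assumes T: "T \<in> tors C" and M: "M \<in> Obj C"
  obtains A D f g where "ses C A M D f g" "A \<in> T" "D \<in> right_perp C T"
proof -
  note TO = tors_Obj[OF T]
  have "\<exists>A D f g. ses C A M D f g \<and> A \<in> T \<and> D \<in> right_perp C T"
    using M
  proof (induction "len C M" arbitrary: M rule: less_induct)
    case less
    show ?case
    proof (cases "M \<in> right_perp C T")
      case True
      have "epic C (Id C M)" "Id C M \<in> Hom C M M"
        using split_epic Id_Hom[OF less.prems] Comp_Id_left by blast+
      then obtain A f where f: "ses C A M M f (Id C M)" using ses_of_epic by blast
      have "f = Zero C A M" using sesD(5)[OF f] Comp_Id_left[OF sesD(1)[OF f]] by simp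
      then have "zero_object C A" using monic_zero_object sesD(1,3)[OF f] by blast
      then show ?thesis using f True zero_object_in_tors[OF T] by blast
    next
      case False
      then obtain X h where h: "X \<in> T" "h \<in> Hom C X M" "h \<noteq> Zero C X M"
        using right_perp_iff[OF TO] less.prems by blast
      obtain I e m where em: "e \<in> Hom C X I" "epic C e" "m \<in> Hom C I M" "monic C m"
        "\<not> zero_object C I"
        using nonzero_image[OF h(2,3)] by metis
      have I: "I \<in> T" using tors_factor[OF T em(1,2) h(1)] .
      obtain Q p where p: "ses C I M Q m p" using ses_of_monic em(3,4) .
      have "len C Q < len C M" using len_ses_less(1)[OF p em(5)] .
      then obtain L N k g where g: "ses C L Q N k g" "L \<in> T" "N \<in> right_perp C T"
        using less.hyps sesD(10)[OF p] by blast
      obtain K \<kappa> s r where "ses C I K L s r" and K: "ses C K M N \<kappa> (g \<cdot> p)"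
        using preimage[OF p sesD(1,3)[OF g(1)]] g(1) by metis
      then have "K \<in> T" using tors_ext[OF T] I g(2) by blast
      then show ?thesis using K g(3) by blast
    qed
  qed
  then show ?thesis using that by blast
qed

text \<open>For \<open>M\<close> in the double perpendicular, the torsion-free quotient in its
  torsion sequence receives only the zero arrow, so it vanishes and \<open>M\<close> equals its
  torsion part.\<close>

lemma left_right_perp:
  assumes T: "T \<in> tors C"
  shows "left_perp C (right_perp C T) = T"
proof
  show "T \<subseteq> left_perp C (right_perp C T)" using subset_left_right_perp tors_Obj[OF T] .
  show "left_perp C (right_perp C T) \<subseteq> T"
  proof
    fix M assume M: "M \<in> left_perp C (right_perp C T)"
    then have "M \<in> Obj C" using perp_Obj by blast
    then obtain A D f g where s: "ses C A M D f g" "A \<in> T" "D \<in> right_perp C T"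
      using torsion_sequence[OF T] by blast
    have "g = Zero C M D"
      using M s(3) left_perp_iff[OF perp_Obj(1)] sesD(2)[OF s(1)] by blast
    then have "zero_object C D" using epic_zero_object sesD(2,4)[OF s(1)] by blast
    then have "epic C f" using ses_zero_right[OF s(1)] iso_arrow_monic_epic(2) sesD(1)[OF s(1)] by blast
    then show "M \<in> T" using tors_factor[OF T sesD(1)[OF s(1)]] s(2) by blast
  qed
qed

lemma generated_tors_least:
  assumes "T \<in> tors C" "\<X> \<subseteq> T"
  shows "left_perp C (right_perp C \<X>) \<subseteq> T"
  using left_perp_antimono[OF right_perp_antimono[OF assms(2)]] left_right_perp[OF assms(1)] by simp

text \<open>This form of the join allows \<open>nonzero_Hom\<close> to produce arrows from the
  joined classes, and it turns joins into meets under duality.\<close>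

lemma tors_join_eq:
  assumes "\<F> \<subseteq> tors C"
  shows "tors_join C \<F> = left_perp C (right_perp C (\<Union>\<F>))"
proof
  have "\<Union>\<F> \<subseteq> Obj C" using assms tors_Obj by blast
  then show "tors_join C \<F> \<subseteq> left_perp C (right_perp C (\<Union>\<F>))"
    using tors_join_least(3)[OF assms left_perp_tors[OF perp_Obj(1)] subset_left_right_perp] by blast
  show "left_perp C (right_perp C (\<Union>\<F>)) \<subseteq> tors_join C \<F>"
    using generated_tors_least[OF tors_join_least(1,2)[OF assms]] .
qed

lemma tors_subset_iff:
  assumes "V \<in> tors C" "W \<in> tors C"
  shows "right_perp C W \<subseteq> right_perp C V \<longleftrightarrow> V \<subseteq> W"
  using assms right_perp_antimono left_perp_antimono left_right_perp by metis

end

section \<open>Wide intervals and join intervals\<close>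

locale torsion_interval = abelian_length_category +
  fixes U T
  assumes U: "U \<in> tors C" and T: "T \<in> tors C" and UT: "U \<subseteq> T"
begin

abbreviation "heart \<equiv> right_perp C U \<inter> T"

lemmas U_Obj = tors_Obj[OF U] and T_Obj = tors_Obj[OF T]

lemma interval_minus_tors: "interval_minus C U T \<subseteq> tors C"
  using U by (auto simp: interval_minus_def tors_interval_def)

section \<open>From wide intervals to join intervals\<close>

lemma join_subset_T: "tors_join C (interval_minus C U T) \<subseteq> T"
  using tors_join_least(3)[OF interval_minus_tors T] UT
  by (auto simp: interval_minus_def tors_interval_def)

text \<open>Some arrow from \<open>X\<close> to \<open>M\<close> is nonzero. Its kernel lies in the
  wide heart, so it is zero by simplicity, and \<open>X\<close> embeds into \<open>M\<close>. The
  quotient \<open>Q\<close> stays in the heart: if it is zero, \<open>M\<close> is isomorphic to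
  \<open>X\<close>; otherwise \<open>Q\<close> maps onto \<open>X\<close> by induction on
  length.\<close>

lemma simple_cover_epic:
  assumes W: "wide_subcategory C heart" and X: "X \<in> heart"
    and simple: "\<And>Y D y d. \<lbrakk>ses C Y X D y d; Y \<in> heart\<rbrakk> \<Longrightarrow> zero_object C Y \<or> zero_object C D"
    and M: "M \<in> left_perp C (right_perp C (insert X U))" "M \<in> right_perp C U" "\<not> zero_object C M"
  shows "\<exists>t. t \<in> Hom C M X \<and> epic C t"
  using M
proof (induction "len C M" arbitrary: M rule: less_induct)
  case less
  let ?V = "left_perp C (right_perp C (insert X U))"
  have XU: "insert X U \<subseteq> Obj C" using X U_Obj T_Obj by blast
  have V: "?V \<in> tors C" using left_perp_tors perp_Obj(1) by blast
  have VT: "?V \<subseteq> T" using generated_tors_least[OF T] X UT by blast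
  obtain A f where "A \<in> insert X U" and f0: "f \<in> Hom C A M" "f \<noteq> Zero C A M"
    using nonzero_Hom[OF XU less.prems(1,3)] .
  \<comment> \<open>Arrows from \<open>U\<close> to \<open>M\<close> vanish, so the nonzero one
    starts at \<open>X\<close>.\<close>
  then have "A = X" using less.prems(2) right_perp_iff[OF U_Obj] by blast
  then have f: "f \<in> Hom C X M" "f \<noteq> Zero C X M" using f0 by auto
  obtain I e m where em: "e \<in> Hom C X I" "epic C e" "m \<in> Hom C I M" "monic C m" "m \<cdot> e = f"
    "\<not> zero_object C I"
    using nonzero_image[OF f] .
  have I: "I \<in> heart" using tors_factor[OF T em(1,2)] X right_perp_sub[OF U_Obj em(3,4) less.prems(2)] by blast
  obtain K k where k: "ses C K X I k e" using ses_of_epic[OF em(1,2)] .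
  have "K \<in> heart"
    using W sesD(6)[OF k] X I Hom_DomCod[OF em(1)] Hom_DomCod[OF sesD(1)[OF k]]
    unfolding wide_subcategory_def closed_kernels_def by metis
  then have "zero_object C K" using simple[OF k] em(6) by blast
  then have "monic C e" using ses_zero_left[OF k] iso_arrow_monic_epic(1)[OF em(1)] by blast
  then have "monic C f" using monic_comp em(1,3,4,5) by blast
  then obtain Q q where q: "ses C X M Q f q" using ses_of_monic f(1) by blast
  show ?case
  proof (cases "zero_object C Q")
    case True
    then have "iso_arrow C f" using ses_zero_right[OF q] by blast
    then obtain t where t: "t \<in> Hom C M X" "t \<cdot> f = Id C X" using iso_arrow_iff[OF f(1)] by blast
    then show ?thesis using split_epic[OF t(1) f(1) t(2)] by blast
  next
    case False
    have "M \<in> heart" using less.prems VT by blast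
    then have "Q \<in> heart"
      using W sesD(7)[OF q] X Hom_DomCod[OF f(1)] Hom_DomCod[OF sesD(2)[OF q]]
      unfolding wide_subcategory_def closed_cokernels_def by metis
    moreover have "Q \<in> ?V" using tors_factor[OF V sesD(2,4)[OF q] less.prems(1)] .
    moreover have "\<not> zero_object C X"
      using zero_object_Hom(1)[of X] f by blast
    then have "len C Q < len C M" using len_ses_less(1)[OF q] by blast
    ultimately obtain t where "t \<in> Hom C Q X" "epic C t" using less.hyps False by blast
    then show ?thesis using Comp_Hom epic_comp sesD(2,4)[OF q] by blast
  qed
qed

text \<open>A torsion class strictly above \<open>U\<close> and inside the generated class contains
  a nonzero object right perpendicular to \<open>U\<close>, namely the torsion-free quotient of any
  of its objects outside \<open>U\<close>. That quotient maps onto \<open>X\<close>, so the class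
  contains every generator.\<close>

lemma simple_cover:
  assumes W: "wide_subcategory C heart" and X: "X \<in> heart" "\<not> zero_object C X"
    and simple: "\<And>Y D y d. \<lbrakk>ses C Y X D y d; Y \<in> heart\<rbrakk> \<Longrightarrow> zero_object C Y \<or> zero_object C D"
  shows "left_perp C (right_perp C (insert X U)) \<in> interval_minus C U T"
proof -
  let ?V = "left_perp C (right_perp C (insert X U))"
  have XU: "insert X U \<subseteq> Obj C" using X U_Obj T_Obj by blast
  have V: "?V \<in> tors C" using left_perp_tors perp_Obj(1) by blast
  have VT: "?V \<subseteq> T" using generated_tors_least[OF T] X UT by blast
  have XV: "insert X U \<subseteq> ?V" using subset_left_right_perp[OF XU] .
  have XnU: "X \<notin> U" using perp_inter_zero[OF U_Obj] X by blast
  have "False" if N: "N \<in> tors C" "U \<subset> N" "N \<subset> ?V" for N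
  proof -
    obtain M where M: "M \<in> N" "M \<notin> U" using N(2) by blast
    then obtain A D f g where s: "ses C A M D f g" "A \<in> U" "D \<in> right_perp C U"
      using torsion_sequence[OF U] tors_Obj[OF N(1)] by blast
    have D: "D \<in> N" using tors_factor[OF N(1) sesD(2,4)[OF s(1)] M(1)] .
    have "\<not> zero_object C D"
      using ses_zero_right[OF s(1)] iso_arrow_monic_epic(2) sesD(1)[OF s(1)]
        tors_factor[OF U] s(2) M(2) by blast
    then obtain t where "t \<in> Hom C D X" "epic C t"
      using simple_cover_epic[OF W X(1), of D] simple D N(3) s(3) by blast
    then have "X \<in> N" using tors_factor[OF N(1)] D by blast
    then show False using generated_tors_least[OF N(1)] N(2,3) by blast
  qed
  then have "hasse_arrow C ?V U"
    using U V XV XnU unfolding hasse_arrow_def by blast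
  then show ?thesis using V VT XV by (auto simp: interval_minus_def tors_interval_def)
qed

text \<open>Induction on length over \<open>T\<close>. An object with nonzero torsion part for
  \<open>U\<close> is an extension of a shorter object by that part. Otherwise it lies in the heart
  and is zero, lies in a cover by \<open>simple_cover\<close>, or is an extension of two shorter
  objects of \<open>T\<close>.\<close>

lemma wide_imp_join:
  assumes W: "wide_subcategory C heart"
  shows "T = tors_join C (interval_minus C U T)"
proof
  let ?J = "tors_join C (interval_minus C U T)"
  have J: "?J \<in> tors C" and JV: "\<Union>(interval_minus C U T) \<subseteq> ?J"
    using tors_join_least[OF interval_minus_tors] by blast+
  have UJ: "U \<subseteq> ?J" using JV by (auto simp: interval_minus_def)
  show "?J \<subseteq> T" using join_subset_T .
  have "X \<in> ?J" if "X \<in> T" for X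
    using that
  proof (induction "len C X" arbitrary: X rule: less_induct)
    case less
    obtain A D f g where s: "ses C A X D f g" "A \<in> U" "D \<in> right_perp C U"
      using torsion_sequence[OF U] less.prems T_Obj by blast
    show ?case
    proof (cases "zero_object C A")
      case False
      have "D \<in> T" using tors_factor[OF T sesD(2,4)[OF s(1)] less.prems] .
      then have "D \<in> ?J" using less.hyps len_ses_less(1)[OF s(1) False] by blast
      then show ?thesis using tors_ext[OF J s(1)] s(2) UJ by blast
    next
      case True
      then have "monic C g" using ses_zero_left[OF s(1)] iso_arrow_monic_epic(1) sesD(2)[OF s(1)] by blast
      then have X: "X \<in> heart"
        using right_perp_sub[OF U_Obj sesD(2)[OF s(1)] _ s(3)] less.prems by blast
      show ?thesis
      proof (cases "\<forall>Y D y d. ses C Y X D y d \<and> Y \<in> heart \<longrightarrow> zero_object C Y \<or> zero_object C D")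
        case True
        show ?thesis
        proof (cases "zero_object C X")
          case True
          then show ?thesis using zero_object_in_tors[OF J] by blast
        next
          case False
          then have "left_perp C (right_perp C (insert X U)) \<in> interval_minus C U T"
            using simple_cover[OF W X(1)] True by blast
          moreover have "X \<in> left_perp C (right_perp C (insert X U))"
            using subset_left_right_perp[of "insert X U"] X U_Obj T_Obj by blast
          ultimately show ?thesis using JV by blast
        qed
      next
        case False
        then obtain Y D y d where y: "ses C Y X D y d" "Y \<in> heart" "\<not> zero_object C Y" "\<not> zero_object C D"
          by blast
        have "D \<in> T" using tors_factor[OF T sesD(2,4)[OF y(1)] less.prems] .
        then have "Y \<in> ?J" "D \<in> ?J" using less.hyps len_ses_less[OF y(1)] y(2,3,4) by blast+
        then show ?thesis using tors_ext[OF J y(1)] by blast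
      qed
    qed
  qed
  then show "T \<subseteq> ?J" by blast
qed

section \<open>From join intervals to wide intervals\<close>

text \<open>
  For a wide interval these are the zero objects and the simple objects of \<open>heart\<close>.
\<close>

definition heart_simple :: "'a \<Rightarrow> bool" where
  "heart_simple S \<longleftrightarrow> S \<in> heart \<and> (\<forall>M\<in>heart. \<forall>f\<in>Hom C S M. f \<noteq> Zero C S M \<longrightarrow>
     monic C f \<and> (\<forall>Q q. ses C S M Q f q \<longrightarrow> Q \<in> heart))"

lemma heart_simpleD:
  assumes "heart_simple S"
  shows "S \<in> heart"
    and "\<lbrakk>M \<in> heart; f \<in> Hom C S M; f \<noteq> Zero C S M\<rbrakk> \<Longrightarrow> monic C f"
    and "\<lbrakk>M \<in> heart; f \<in> Hom C S M; f \<noteq> Zero C S M; ses C S M Q f q\<rbrakk> \<Longrightarrow> Q \<in> heart"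
  using assms unfolding heart_simple_def by blast+

text \<open>Induction on the length of \<open>M\<close>, splitting off a subobject \<open>S\<close>
  with quotient \<open>Q\<close> in the heart. Either \<open>f\<close> kills \<open>S\<close> and
  descends to \<open>Q\<close>, or it embeds \<open>S\<close> into \<open>N\<close> and descends to
  an arrow from \<open>Q\<close> to the quotient \<open>R\<close> of \<open>N\<close> by
  \<open>S\<close>. Half of heart membership is claimed: \<open>K\<close> is right perpendicular to
  \<open>U\<close> as a subobject of \<open>M\<close>, and \<open>D\<close> lies in \<open>T\<close>
  as a factor of \<open>N\<close>.\<close>

lemma kernel_cokernel_in_heart:
  assumes good: "\<And>M. \<lbrakk>M \<in> heart; \<not> zero_object C M\<rbrakk> \<Longrightarrow>
      \<exists>S i. heart_simple S \<and> i \<in> Hom C S M \<and> i \<noteq> Zero C S M"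
    and M: "M \<in> heart" and N: "N \<in> heart" and f: "f \<in> Hom C M N"
  shows "\<exists>K k D p. k \<in> Hom C K M \<and> is_kernel C f k \<and> K \<in> T \<and>
    p \<in> Hom C N D \<and> is_cokernel C f p \<and> D \<in> right_perp C U"
  using M N f
proof (induction "len C M" arbitrary: M N f rule: less_induct)
  case less
  note f = less.prems(3)
  have MO: "M \<in> Obj C" and NO: "N \<in> Obj C" using Hom_Obj[OF f] by auto
  show ?case
  proof (cases "zero_object C M")
    case True
    have f0: "f = Zero C M N" using zero_object_Hom(1)[OF True f] .
    have "monic C (Id C M)" "epic C (Id C N)"
      using split_epic[of "Id C N" N N "Id C N"] Id_Hom Comp_Id_left NO
        iso_arrow_monic_epic(1)[of "Id C M" M M] iso_arrow_iff[of "Id C M" M M] MO by blast+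
    then have "is_kernel C f (Id C M)" "is_cokernel C f (Id C N)"
      using is_kernel_iff[OF f Id_Hom[OF MO]] is_cokernel_iff[OF f Id_Hom[OF NO]]
        Comp_Id_left Comp_Id_right f f0 by auto
    then show ?thesis using less.prems Id_Hom MO NO by blast
  next
    case False
    then obtain S i where S: "heart_simple S" and i: "i \<in> Hom C S M" "i \<noteq> Zero C S M"
      using good less.prems(1) by blast
    have SH: "S \<in> heart" using heart_simpleD(1)[OF S] .
    have "monic C i" using heart_simpleD(2)[OF S less.prems(1) i] .
    then obtain Q q where q: "ses C S M Q i q" using ses_of_monic i(1) by blast
    have Q: "Q \<in> heart" using heart_simpleD(3)[OF S less.prems(1) i q] .
    note q' = sesD[OF q]
    have "\<not> zero_object C S" using zero_object_Hom(1)[of S] i by blast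
    then have lQ: "len C Q < len C M" using len_ses_less(1)[OF q] by blast
    show ?thesis
    proof (cases "f \<cdot> i = Zero C S N")
      \<comment> \<open>The kernel of \<open>f\<close> is the preimage of that of \<open>f'\<close>,
        hence an extension of it by \<open>S\<close>; the cokernels of \<open>f\<close> and
        \<open>f'\<close> agree because \<open>q\<close> is epic.\<close>
      case True
      obtain f' where f': "f' \<in> Hom C Q N" "f' \<cdot> q = f" using ses_colift[OF q f True] .
      obtain K' k' D p where k': "k' \<in> Hom C K' Q" "is_kernel C f' k'" "K' \<in> T"
        and p: "p \<in> Hom C N D" "is_cokernel C f' p" "D \<in> right_perp C U"
        using less.hyps[OF lQ Q less.prems(2) f'(1)] by blast
      have k'm: "monic C k'" and fk': "f' \<cdot> k' = Zero C K' N"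
        using is_kernel_iff[OF f'(1) k'(1)] k'(2) by auto
      obtain K \<kappa> s r where \<kappa>: "\<kappa> \<in> Hom C K M" "monic C \<kappa>" "q \<cdot> \<kappa> = k' \<cdot> r" "ses C S K K' s r"
        and univ: "\<And>X h u. \<lbrakk>h \<in> Hom C X M; u \<in> Hom C X K'; q \<cdot> h = k' \<cdot> u\<rbrakk> \<Longrightarrow> \<exists>v \<in> Hom C X K. \<kappa> \<cdot> v = h"
        using preimage[OF q k'(1) k'm] by metis
      note r = sesD(2)[OF \<kappa>(4)]
      have K: "K \<in> T" using tors_ext[OF T \<kappa>(4)] SH k'(3) by blast
      have "f \<cdot> \<kappa> = f' \<cdot> k' \<cdot> r"
        using f'(2) Comp_assoc[OF \<kappa>(1) q'(2) f'(1)] Comp_assoc[OF r k'(1) f'(1)] \<kappa>(3) by simp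
      then have f\<kappa>: "f \<cdot> \<kappa> = Zero C K N" using fk' Comp_Zero_left[OF r NO] by simp
      have "\<exists>v\<in>Hom C X K. \<kappa> \<cdot> v = h" if h: "h \<in> Hom C X M" "f \<cdot> h = Zero C X N" for X h
      proof -
        have "f' \<cdot> (q \<cdot> h) = Zero C X N" using f'(2) Comp_assoc[OF h(1) q'(2) f'(1)] h(2) by simp
        then obtain u where "u \<in> Hom C X K'" "k' \<cdot> u = q \<cdot> h"
          using k'(2) is_kernel_iff[OF f'(1) k'(1)] Comp_Hom[OF h(1) q'(2)] by blast
        then show ?thesis using univ[OF h(1)] by simp
      qed
      then have ker: "is_kernel C f \<kappa>" using is_kernel_iff[OF f \<kappa>(1)] \<kappa>(2) f\<kappa> by blast
      have pe: "epic C p" and pf': "p \<cdot> f' = Zero C Q D"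
        using is_cokernel_iff[OF f'(1) p(1)] p(2) by auto
      have "p \<cdot> f = p \<cdot> f' \<cdot> q" using Comp_assoc[OF q'(2) f'(1) p(1)] f'(2) by simp
      then have pf: "p \<cdot> f = Zero C M D"
        using pf' Comp_Zero_left[OF q'(2) Hom_Obj(2)[OF p(1)]] by simp
      have "\<exists>v\<in>Hom C D X. v \<cdot> p = h" if h: "h \<in> Hom C N X" "h \<cdot> f = Zero C M X" for X h
      proof -
        have "h \<cdot> f' \<cdot> q = Zero C M X" using Comp_assoc[OF q'(2) f'(1) h(1)] f'(2) h(2) by simp
        then have "h \<cdot> f' = Zero C Q X" using epicD[OF q'(4,2)] Comp_Hom[OF f'(1) h(1)] by blast
        then show ?thesis using is_cokernel_iff[OF f'(1) p(1)] p(2) h(1) by blast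
      qed
      then have "is_cokernel C f p" using is_cokernel_iff[OF f p(1)] pe pf by blast
      then show ?thesis using ker \<kappa>(1) K p(1,3) by blast
    next
      \<comment> \<open>The preimage \<open>P\<close> of the kernel of \<open>f'\<close> lies in
        \<open>T\<close> and contains the kernel \<open>K\<close> of \<open>f\<close>. The aim is to
        show that \<open>K\<close> is a direct summand of \<open>P\<close> with complement
        \<open>S\<close>, hence a factor of it.\<close>
      case False
      define j where "j = f \<cdot> i"
      have j: "j \<in> Hom C S N" using Comp_Hom[OF i(1) f] by (simp add: j_def)
      have j0: "j \<noteq> Zero C S N" using False by (simp add: j_def)
      have jm: "monic C j" using heart_simpleD(2)[OF S less.prems(2) j j0] .
      then obtain R \<sigma> where \<sigma>: "ses C S N R j \<sigma>" using ses_of_monic j by blast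
      have R: "R \<in> heart" using heart_simpleD(3)[OF S less.prems(2) j j0 \<sigma>] .
      note \<sigma>' = sesD[OF \<sigma>]
      have \<sigma>f: "\<sigma> \<cdot> f \<in> Hom C M R" using Comp_Hom[OF f \<sigma>'(2)] .
      have "\<sigma> \<cdot> f \<cdot> i = Zero C S R" using Comp_assoc[OF i(1) f \<sigma>'(2)] \<sigma>'(5) by (simp add: j_def)
      then obtain f' where f': "f' \<in> Hom C Q R" "f' \<cdot> q = \<sigma> \<cdot> f" using ses_colift[OF q \<sigma>f] by blast
      obtain K' k' D p where k': "k' \<in> Hom C K' Q" "is_kernel C f' k'" "K' \<in> T"
        and p: "p \<in> Hom C R D" "is_cokernel C f' p" "D \<in> right_perp C U"
        using less.hyps[OF lQ Q R f'(1)] by blast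
      have k'm: "monic C k'" and fk': "f' \<cdot> k' = Zero C K' R"
        using is_kernel_iff[OF f'(1) k'(1)] k'(2) by auto
      obtain P \<kappa> s r where \<kappa>: "\<kappa> \<in> Hom C P M" "monic C \<kappa>" "\<kappa> \<cdot> s = i" "q \<cdot> \<kappa> = k' \<cdot> r" "ses C S P K' s r"
        and univ: "\<And>X h u. \<lbrakk>h \<in> Hom C X M; u \<in> Hom C X K'; q \<cdot> h = k' \<cdot> u\<rbrakk> \<Longrightarrow> \<exists>v \<in> Hom C X P. \<kappa> \<cdot> v = h"
        using preimage[OF q k'(1) k'm] by metis
      note r = sesD(2)[OF \<kappa>(5)] and s = sesD(1)[OF \<kappa>(5)]
      have P: "P \<in> T" using tors_ext[OF T \<kappa>(5)] SH k'(3) by blast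
      have PO: "P \<in> Obj C" using Hom_Obj(2)[OF s] .
      have f\<kappa>H: "f \<cdot> \<kappa> \<in> Hom C P N" using Comp_Hom[OF \<kappa>(1) f] .
      have "\<sigma> \<cdot> (f \<cdot> \<kappa>) = f' \<cdot> k' \<cdot> r"
        using f'(2) Comp_assoc[OF \<kappa>(1) f \<sigma>'(2)] Comp_assoc[OF \<kappa>(1) q'(2) f'(1)]
          Comp_assoc[OF r k'(1) f'(1)] \<kappa>(4) by simp
      then have "\<sigma> \<cdot> (f \<cdot> \<kappa>) = Zero C P R" using fk' Comp_Zero_left[OF r \<sigma>'(10)] by simp
      \<comment> \<open>On \<open>P\<close> the arrow \<open>f\<close> lands in the copy of
        \<open>S\<close> inside \<open>N\<close>; \<open>t\<close> is \<open>f\<close> read as an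
        arrow to \<open>S\<close>.\<close>
      then obtain t where t: "t \<in> Hom C P S" "j \<cdot> t = f \<cdot> \<kappa>" using ses_lift[OF \<sigma> f\<kappa>H] by blast
      obtain k where k: "is_kernel C f k" using ex_kernel Hom_DomCod(3)[OF f] by blast
      define K where "K = Dom C k"
      have kH: "k \<in> Hom C K M" using is_kernel_Hom[OF k f] by (simp add: K_def)
      have KO: "K \<in> Obj C" using Hom_Obj(1)[OF kH] .
      have km: "monic C k" and fk: "f \<cdot> k = Zero C K N" using is_kernel_iff[OF f kH] k by auto
      have "f' \<cdot> (q \<cdot> k) = \<sigma> \<cdot> (f \<cdot> k)"
        using f'(2) Comp_assoc[OF kH q'(2) f'(1)] Comp_assoc[OF kH f \<sigma>'(2)] by simp
      also have "\<dots> = Zero C K R" using fk Comp_Zero_right[OF \<sigma>'(2) KO] by simp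
      finally obtain u where "u \<in> Hom C K K'" "k' \<cdot> u = q \<cdot> k"
        using k'(2) is_kernel_iff[OF f'(1) k'(1)] Comp_Hom[OF kH q'(2)] by blast
      then obtain v where v: "v \<in> Hom C K P" "\<kappa> \<cdot> v = k" using univ[OF kH] by metis
      have tv: "t \<cdot> v = Zero C K S"
      proof -
        have "j \<cdot> (t \<cdot> v) = f \<cdot> k"
          using Comp_assoc[OF v(1) t(1) j] Comp_assoc[OF v(1) \<kappa>(1) f] t(2) v(2) by simp
        then show ?thesis using monicD[OF jm j _ Comp_Hom[OF v(1) t(1)]] fk by simp
      qed
      have st: "s \<cdot> t \<in> Hom C P P" using Comp_Hom[OF t(1) s] .
      \<comment> \<open>\<open>d\<close> is the identity minus \<open>s \<cdot> t\<close>, the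
        projection along \<open>S\<close>. It is killed by \<open>f \<cdot> \<kappa>\<close>, so it
        factors through \<open>K\<close> as \<open>w\<close>, and it fixes \<open>K\<close> because
        \<open>t\<close> vanishes there.\<close>
      obtain d where d: "d \<in> Hom C P P" "Add C d (s \<cdot> t) = Id C P"
        using ex_difference[OF Id_Hom[OF PO] st] by blast
      have f\<kappa>st: "f \<cdot> \<kappa> \<cdot> (s \<cdot> t) = f \<cdot> \<kappa>"
        using Comp_assoc[OF t(1) s f\<kappa>H] Comp_assoc[OF s \<kappa>(1) f] \<kappa>(3) t(2) by (simp add: j_def)
      have "Add C (f \<cdot> \<kappa> \<cdot> d) (f \<cdot> \<kappa>) = f \<cdot> \<kappa>"
        using Comp_Add_right[OF d(1) st f\<kappa>H] d(2) f\<kappa>st Comp_Id_right[OF f\<kappa>H] by simp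
      then have "f \<cdot> \<kappa> \<cdot> d = Zero C P N"
        using Add_eq_right_iff[OF Comp_Hom[OF d(1) f\<kappa>H] f\<kappa>H] by blast
      then have "f \<cdot> (\<kappa> \<cdot> d) = Zero C P N" using Comp_assoc[OF d(1) \<kappa>(1) f] by simp
      then obtain w where w: "w \<in> Hom C P K" "k \<cdot> w = \<kappa> \<cdot> d"
        using is_kernel_iff[OF f kH] k Comp_Hom[OF d(1) \<kappa>(1)] by blast
      have "s \<cdot> t \<cdot> v = Zero C K P"
        using Comp_assoc[OF v(1) t(1) s] tv Comp_Zero_right[OF s KO] by simp
      then have "Add C (d \<cdot> v) (Zero C K P) = v"
        using Comp_Add_left[OF v(1) d(1) st] d(2) Comp_Id_left[OF v(1)] by simp
      then have dv: "d \<cdot> v = v" using Add_Zero(1)[OF Comp_Hom[OF v(1) d(1)]] by simp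
      have "k \<cdot> (w \<cdot> v) = k \<cdot> Id C K"
        using Comp_assoc[OF v(1) w(1) kH] Comp_assoc[OF v(1) d(1) \<kappa>(1)] w(2) dv v(2)
          Comp_Id_right[OF kH] by simp
      then have "w \<cdot> v = Id C K"
        using monic_cancel[OF km kH] Comp_Hom[OF v(1) w(1)] Id_Hom[OF KO] by blast
      then have "epic C w" using split_epic[OF w(1) v(1)] by blast
      then have K: "K \<in> T" using tors_factor[OF T w(1)] P by blast
      have pe: "epic C p" and pf': "p \<cdot> f' = Zero C Q D"
        using is_cokernel_iff[OF f'(1) p(1)] p(2) by auto
      \<comment> \<open>The cokernel of \<open>f\<close> is that of \<open>f'\<close>: an arrow that
        kills \<open>f\<close> kills \<open>j\<close>, so it factors through
        \<open>\<sigma>\<close>.\<close>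
      have p\<sigma>: "p \<cdot> \<sigma> \<in> Hom C N D" using Comp_Hom[OF \<sigma>'(2) p(1)] .
      have p\<sigma>e: "epic C (p \<cdot> \<sigma>)" using epic_comp[OF \<sigma>'(4,2) pe p(1)] .
      have "p \<cdot> \<sigma> \<cdot> f = p \<cdot> f' \<cdot> q"
        using Comp_assoc[OF q'(2) f'(1) p(1)] Comp_assoc[OF f \<sigma>'(2) p(1)] f'(2) by simp
      then have p\<sigma>f: "p \<cdot> \<sigma> \<cdot> f = Zero C M D"
        using pf' Comp_Zero_left[OF q'(2) Hom_Obj(2)[OF p(1)]] by simp
      have "\<exists>v\<in>Hom C D X. v \<cdot> (p \<cdot> \<sigma>) = h" if h: "h \<in> Hom C N X" "h \<cdot> f = Zero C M X" for X h
      proof -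
        have "h \<cdot> j = h \<cdot> f \<cdot> i" using Comp_assoc[OF i(1) f h(1)] by (simp add: j_def)
        then have "h \<cdot> j = Zero C S X" using h(2) Comp_Zero_left[OF i(1) Hom_Obj(2)[OF h(1)]] by simp
        then obtain h' where h': "h' \<in> Hom C R X" "h' \<cdot> \<sigma> = h" using ses_colift[OF \<sigma> h(1)] by blast
        have "h' \<cdot> f' \<cdot> q = h \<cdot> f"
          using Comp_assoc[OF q'(2) f'(1) h'(1)] Comp_assoc[OF f \<sigma>'(2) h'(1)] f'(2) h'(2) by simp
        then have "h' \<cdot> f' = Zero C Q X"
          using epicD[OF q'(4,2)] Comp_Hom[OF f'(1) h'(1)] h(2) by simp
        then obtain v where v: "v \<in> Hom C D X" "v \<cdot> p = h'"
          using is_cokernel_iff[OF f'(1) p(1)] p(2) h'(1) by blast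
        then have "v \<cdot> (p \<cdot> \<sigma>) = h" using Comp_assoc[OF \<sigma>'(2) p(1) v(1)] h'(2) by simp
        then show ?thesis using v(1) by blast
      qed
      then have "is_cokernel C f (p \<cdot> \<sigma>)" using is_cokernel_iff[OF f p\<sigma>] p\<sigma>e p\<sigma>f by blast
      then show ?thesis using kH k K p\<sigma> p(3) by blast
    qed
  qed
qed

lemma T_iso: "\<lbrakk>A \<in> T; isomorphic C A B\<rbrakk> \<Longrightarrow> B \<in> T"
  using T closed_factors_iso by (auto simp: tors_def torsion_class_def)

lemma right_perp_U_iso: "\<lbrakk>A \<in> right_perp C U; isomorphic C A B\<rbrakk> \<Longrightarrow> B \<in> right_perp C U"
  using isomorphic_sym[of A B] right_perp_sub[OF U_Obj] iso_arrow_monic_epic(1)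
  unfolding isomorphic_def by blast

text \<open>An arbitrary kernel is isomorphic to the one found in
  \<open>kernel_cokernel_in_heart\<close>, which places it in \<open>T\<close>; being a subobject it
  is right perpendicular to \<open>U\<close>. Cokernels are dual.\<close>

lemma wide_if_heart_simple_maps:
  assumes "\<And>M. \<lbrakk>M \<in> heart; \<not> zero_object C M\<rbrakk> \<Longrightarrow>
      \<exists>S i. heart_simple S \<and> i \<in> Hom C S M \<and> i \<noteq> Zero C S M"
  shows "wide_subcategory C heart"
proof -
  obtain Z where "zero_object C Z" using ex_zero_object by blast
  then have "Z \<in> heart" using right_perp_zero[OF U_Obj] zero_object_in_tors[OF T] by blast
  then have "subcategory C heart"
    using T_Obj T_iso right_perp_U_iso unfolding subcategory_def by blast
  moreover have "Dom C l \<in> heart" if l: "is_kernel C f l" "Dom C f \<in> heart" "Cod C f \<in> heart" for f l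
  proof -
    have f: "f \<in> Hom C (Dom C f) (Cod C f)" using HomI l(1) by (simp add: is_kernel_def)
    have lH: "l \<in> Hom C (Dom C l) (Dom C f)" using is_kernel_Hom[OF l(1) f] .
    obtain K k where k: "k \<in> Hom C K (Dom C f)" "is_kernel C f k" "K \<in> T"
      using kernel_cokernel_in_heart[OF assms l(2,3) f] by blast
    have "Dom C l \<in> T" using T_iso[OF k(3) kernel_iso[OF f k(1,2) lH l(1)]] .
    moreover have "Dom C l \<in> right_perp C U"
      using right_perp_sub[OF U_Obj lH] is_kernel_iff[OF f lH] l(1,2) by blast
    ultimately show ?thesis by blast
  qed
  then have "closed_kernels C heart" unfolding closed_kernels_def by blast
  moreover have "Cod C l \<in> heart" if l: "is_cokernel C f l" "Dom C f \<in> heart" "Cod C f \<in> heart" for f l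
  proof -
    have f: "f \<in> Hom C (Dom C f) (Cod C f)" using HomI l(1) by (simp add: is_cokernel_def)
    have lH: "l \<in> Hom C (Cod C f) (Cod C l)" using is_cokernel_Hom[OF l(1) f] .
    obtain D p where p: "p \<in> Hom C (Cod C f) D" "is_cokernel C f p" "D \<in> right_perp C U"
      using kernel_cokernel_in_heart[OF assms l(2,3) f] by blast
    have "Cod C l \<in> right_perp C U"
      using right_perp_U_iso[OF p(3) cokernel_iso[OF f p(1,2) lH l(1)]] .
    moreover have "Cod C l \<in> T"
      using tors_factor[OF T lH] is_cokernel_iff[OF f lH] l(1,3) by blast
    ultimately show ?thesis by blast
  qed
  then have "closed_cokernels C heart" unfolding closed_cokernels_def by blast
  moreover have "Cod C f \<in> heart" if f: "short_exact C f g" "Dom C f \<in> heart" "Cod C g \<in> heart" for f g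
  proof -
    have "ses C (Dom C f) (Cod C f) (Cod C g) f g"
      using f(1) by (auto simp: ses_def short_exact_def is_cokernel_def Hom_def)
    then show ?thesis using tors_ext[OF T] right_perp_ext[OF U_Obj] f(2,3) by blast
  qed
  then have "closed_extensions C heart" unfolding closed_extensions_def by blast
  ultimately show ?thesis unfolding wide_subcategory_def by blast
qed

text \<open>As \<open>V\<close> covers \<open>U\<close> and \<open>S\<close> lies outside
  \<open>U\<close>, the class \<open>V\<close> is generated by \<open>U\<close> and
  \<open>S\<close>. So \<open>K\<close> receives a nonzero arrow from a generator, and none comes
  from \<open>U\<close>.\<close>

lemma cover_nonzero_Hom:
  assumes V: "hasse_arrow C V U"
    and S: "S \<in> V" "S \<in> right_perp C U" "\<not> zero_object C S"
    and K: "K \<in> V" "K \<in> right_perp C U" "\<not> zero_object C K"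
  obtains f where "f \<in> Hom C S K" "f \<noteq> Zero C S K"
proof -
  have Vt: "V \<in> tors C" and UV: "U \<subseteq> V" using V by (auto simp: hasse_arrow_def)
  have SU: "insert S U \<subseteq> Obj C" using tors_Obj[OF Vt] S(1) UV by blast
  let ?W = "left_perp C (right_perp C (insert S U))"
  have W: "?W \<in> tors C" "insert S U \<subseteq> ?W" "?W \<subseteq> V"
    using left_perp_tors[OF perp_Obj(1)] subset_left_right_perp[OF SU]
      generated_tors_least[OF Vt, of "insert S U"] S(1) UV by blast+
  have "S \<notin> U" using perp_inter_zero[OF U_Obj] S by blast
  then have "?W = V" using V W unfolding hasse_arrow_def by blast
  then obtain A f where f: "A \<in> insert S U" "f \<in> Hom C A K" "f \<noteq> Zero C A K"
    using nonzero_Hom[OF SU _ K(3)] K(1) by blast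
  then have "A = S" using K(2) right_perp_iff[OF U_Obj] by blast
  then show ?thesis using that f by blast
qed

text \<open>The image of a nonzero arrow from \<open>S\<close> lies in \<open>V\<close> and is right
  perpendicular to \<open>U\<close>, so by minimality nothing is lost and the arrow is monic. For
  the cokernel, the torsion part \<open>A\<close> with respect to \<open>U\<close> is shown to
  vanish by splitting the extension of \<open>A\<close> by \<open>S\<close> that it induces.\<close>

lemma minimal_is_heart_simple:
  assumes V: "hasse_arrow C V U" "V \<subseteq> T"
    and S: "S \<in> V" "S \<in> right_perp C U" "\<not> zero_object C S"
    and min: "\<And>I. \<lbrakk>I \<in> V; I \<in> right_perp C U; \<not> zero_object C I\<rbrakk> \<Longrightarrow> len C S \<le> len C I"
  shows "heart_simple S"
proof -
  have Vt: "V \<in> tors C" and UV: "U \<subseteq> V" using V by (auto simp: hasse_arrow_def)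
  have SO: "S \<in> Obj C" using tors_Obj[OF Vt] S(1) by blast
  have mono: "monic C f" if f: "M \<in> right_perp C U" "f \<in> Hom C S M" "f \<noteq> Zero C S M" for M f
  proof -
    obtain I e m where em: "e \<in> Hom C S I" "epic C e" "m \<in> Hom C I M" "monic C m" "m \<cdot> e = f"
      "\<not> zero_object C I"
      using nonzero_image[OF f(2,3)] .
    have "I \<in> V" "I \<in> right_perp C U"
      using tors_factor[OF Vt em(1,2) S(1)] right_perp_sub[OF U_Obj em(3,4) f(1)] .
    then have "len C S \<le> len C I" using min em(6) by blast
    moreover obtain K k where k: "ses C K S I k e" using ses_of_epic[OF em(1,2)] .
    ultimately have "zero_object C K" using len_ses_less(1)[OF k] by fastforce
    then have "monic C e" using ses_zero_left[OF k] iso_arrow_monic_epic(1)[OF em(1)] by blast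
    then show ?thesis using monic_comp[OF _ em(1,4,3)] em(5) by simp
  qed
  have "Q \<in> heart" if q: "M \<in> heart" "ses C S M Q f q" for M Q f q
  proof -
    have QT: "Q \<in> T" using tors_factor[OF T sesD(2,4)[OF q(2)]] q(1) by blast
    then obtain A D a b where ab: "ses C A Q D a b" "A \<in> U" "D \<in> right_perp C U"
      using torsion_sequence[OF U] T_Obj by blast
    \<comment> \<open>\<open>K\<close> is the preimage of \<open>A\<close> in \<open>M\<close>. It
      is in \<open>V\<close> as an extension of \<open>A\<close> by \<open>S\<close>, and right
      perpendicular to \<open>U\<close> as a subobject of \<open>M\<close>.\<close>
    obtain K \<kappa> s r where \<kappa>: "\<kappa> \<in> Hom C K M" "monic C \<kappa>" and sr: "ses C S K A s r"
      using preimage[OF q(2) sesD(1,3)[OF ab(1)]] by metis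
    note s = sesD[OF sr]
    have K: "K \<in> V" "K \<in> right_perp C U"
      using tors_ext[OF Vt sr S(1)] ab(2) UV right_perp_sub[OF U_Obj \<kappa>] q(1) by blast+
    have "\<not> zero_object C K"
    proof
      assume "zero_object C K"
      then have "s = Zero C S K" using zero_object_Hom(2) s(1) by blast
      then show False using monic_zero_object[OF s(3,1)] S(3) by blast
    qed
    then obtain t where t: "t \<in> Hom C K S" "t \<noteq> Zero C K S"
      using cover_nonzero_Hom[OF V(1) K _ S] by blast
    have ts: "t \<cdot> s \<in> Hom C S S" using Comp_Hom[OF s(1) t(1)] .
    \<comment> \<open>An arrow from \<open>K\<close> that vanishes on \<open>S\<close> factors
      through \<open>A\<close> in \<open>U\<close>, which has no nonzero arrows to
      \<open>S\<close>.\<close>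
    have "t \<cdot> s \<noteq> Zero C S S"
    proof
      assume "t \<cdot> s = Zero C S S"
      then obtain u where u: "u \<in> Hom C A S" "u \<cdot> r = t" using ses_colift[OF sr t(1)] by blast
      have "u = Zero C A S" using S(2) right_perp_iff[OF U_Obj] ab(2) u(1) by blast
      then show False using u(2) t(2) Comp_Zero_left[OF s(2) SO] by simp
    qed
    then have "monic C (t \<cdot> s)" using mono[OF S(2) ts] by blast
    then obtain E c where c: "ses C S S E (t \<cdot> s) c" using ses_of_monic ts by blast
    \<comment> \<open>A nonzero cokernel of a monic endomorphism of \<open>S\<close> would make
      \<open>S\<close> shorter than itself.\<close>
    then have "zero_object C E" using len_ses_less(2)[OF c] by blast
    then have "iso_arrow C (t \<cdot> s)" using ses_zero_right[OF c] by blast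
    then obtain w where w: "w \<in> Hom C S S" "w \<cdot> (t \<cdot> s) = Id C S"
      using iso_arrow_iff[OF ts] by blast
    have wt: "w \<cdot> t \<in> Hom C K S" using Comp_Hom[OF t(1) w(1)] .
    have swt: "s \<cdot> (w \<cdot> t) \<in> Hom C K K" using Comp_Hom[OF wt s(1)] .
    \<comment> \<open>\<open>d\<close> is the identity minus the idempotent given by the retraction
      \<open>w \<cdot> t\<close> of \<open>s\<close>. It vanishes on \<open>S\<close>, so it factors
      through \<open>A\<close> and is zero; hence \<open>s\<close> is epic and \<open>A\<close> is
      zero.\<close>
    obtain d where d: "d \<in> Hom C K K" "Add C d (s \<cdot> (w \<cdot> t)) = Id C K"
      using ex_difference[OF Id_Hom[OF s(9)] swt] by blast
    have "s \<cdot> (w \<cdot> t) \<cdot> s = s"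
      using Comp_assoc[OF s(1) wt s(1)] Comp_assoc[OF s(1) t(1) w(1)] w(2) Comp_Id_right[OF s(1)]
      by simp
    then have "Add C (d \<cdot> s) s = s"
      using Comp_Add_left[OF s(1) d(1) swt] d(2) Comp_Id_left[OF s(1)] by simp
    then have "d \<cdot> s = Zero C S K" using Add_eq_right_iff[OF Comp_Hom[OF s(1) d(1)] s(1)] by blast
    then obtain u where u: "u \<in> Hom C A K" "u \<cdot> r = d" using ses_colift[OF sr d(1)] by blast
    have "u = Zero C A K" using K(2) right_perp_iff[OF U_Obj] ab(2) u(1) by blast
    then have "d = Zero C K K" using u(2) Comp_Zero_left[OF s(2,9)] by simp
    then have "s \<cdot> (w \<cdot> t) = Id C K" using d(2) Add_Zero(2)[OF swt] by simp
    then have "epic C s" using split_epic[OF s(1) wt] by blast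
    then have "r = Zero C K A" using epicD[OF _ s(1,5,2)] by blast
    then have "zero_object C A" using epic_zero_object[OF s(4,2)] by blast
    then have "monic C b"
      using ses_zero_left[OF ab(1)] iso_arrow_monic_epic(1)[OF sesD(2)[OF ab(1)]] by blast
    then have "Q \<in> right_perp C U" using right_perp_sub[OF U_Obj sesD(2)[OF ab(1)] _ ab(3)] by blast
    then show ?thesis using QT by blast
  qed
  then show ?thesis using mono S V(2) unfolding heart_simple_def by blast
qed

text \<open>A nonzero \<open>M\<close> in the heart receives a nonzero arrow from an object of some
  class in \<open>interval_minus\<close>. This class is not \<open>U\<close>, so it covers
  \<open>U\<close>, and the image \<open>I\<close> shows that it has nonzero objects right
  perpendicular to \<open>U\<close>. A shortest one is heart-simple and maps nontrivially to
  \<open>I\<close>, hence to \<open>M\<close>.\<close>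

lemma join_imp_wide:
  assumes J: "T = tors_join C (interval_minus C U T)"
  shows "wide_subcategory C heart"
proof (rule wide_if_heart_simple_maps)
  fix M assume M: "M \<in> heart" "\<not> zero_object C M"
  have XO: "\<Union>(interval_minus C U T) \<subseteq> Obj C" using interval_minus_tors tors_Obj by blast
  have "M \<in> left_perp C (right_perp C (\<Union>(interval_minus C U T)))"
    using M(1) J tors_join_eq[OF interval_minus_tors] by blast
  then obtain A f where "A \<in> \<Union>(interval_minus C U T)" and f: "f \<in> Hom C A M" "f \<noteq> Zero C A M"
    using nonzero_Hom[OF XO _ M(2)] by blast
  then obtain V where V: "V \<in> interval_minus C U T" "A \<in> V" by blast
  have "A \<notin> U" using M(1) f right_perp_iff[OF U_Obj] by blast
  then have VU: "hasse_arrow C V U" and VT: "V \<subseteq> T"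
    using V by (auto simp: interval_minus_def tors_interval_def)
  have Vt: "V \<in> tors C" using VU by (auto simp: hasse_arrow_def)
  obtain I e m where em: "e \<in> Hom C A I" "epic C e" "m \<in> Hom C I M" "monic C m"
    "\<not> zero_object C I"
    using nonzero_image[OF f] by metis
  let ?P = "\<lambda>I. I \<in> V \<and> I \<in> right_perp C U \<and> \<not> zero_object C I"
  have I: "?P I"
    using tors_factor[OF Vt em(1,2) V(2)] right_perp_sub[OF U_Obj em(3,4)] M(1) em(5) by blast
  define S where "S = arg_min (len C) ?P"
  have S: "?P S" "\<And>I. ?P I \<Longrightarrow> len C S \<le> len C I"
    using arg_min_nat_lemma[of ?P I "len C"] I unfolding S_def by blast+
  then have good: "heart_simple S" using minimal_is_heart_simple[OF VU VT] by blast
  obtain h where h: "h \<in> Hom C S I" "h \<noteq> Zero C S I"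
    using cover_nonzero_Hom[OF VU] S(1) I by blast
  have "m \<cdot> h \<noteq> Zero C S M" using monicD[OF em(4,3) _ h(1)] h(2) by blast
  then show "\<exists>S i. heart_simple S \<and> i \<in> Hom C S M \<and> i \<noteq> Zero C S M"
    using good Comp_Hom[OF h(1) em(3)] by blast
qed

lemma wide_iff_join: "wide_interval C U T \<longleftrightarrow> join_interval C U T"
  unfolding wide_interval_def join_interval_def using wide_imp_join join_imp_wide by blast

end

section \<open>Duality\<close>

lemma closed_kernels_opposite [simp]: "closed_kernels (opposite C) = closed_cokernels C"
  unfolding closed_kernels_def closed_cokernels_def fun_eq_iff
  by (simp add: conj_commute conj_left_commute)

lemma closed_cokernels_opposite [simp]: "closed_cokernels (opposite C) = closed_kernels C"
  unfolding closed_kernels_def closed_cokernels_def fun_eq_iff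
  by (simp add: conj_commute conj_left_commute)

text \<open>The middle term is named as the codomain of the first arrow, which in the opposite
  category becomes the domain of the second; exactness identifies the two.\<close>

lemma closed_extensions_opposite [simp]: "closed_extensions (opposite C) X = closed_extensions C X"
proof -
  have "Cod C f = Dom C g" if "short_exact C f g" for f g
    using that by (simp add: short_exact_def is_cokernel_def)
  then show ?thesis
    unfolding closed_extensions_def short_exact_opposite opposite_simps by metis
qed

lemma (in category) wide_subcategory_opposite [simp]:
  "wide_subcategory (opposite C) W = wide_subcategory C W"
  by (simp add: wide_subcategory_def subcategory_def conj_commute conj_left_commute)

section \<open>Torsion classes of the opposite category\<close>

context abelian_length_category
begin

text \<open>Every torsion class of the opposite category is the right perpendicular of its left
  perpendicular, by \<open>left_right_perp\<close> applied there.\<close>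

lemma tors_opposite: "tors (opposite C) = right_perp C ` tors C"
proof -
  interpret O: abelian_length_category "opposite C" by (rule abelian_length_category_opposite)
  have "W \<in> right_perp C ` tors C" if W: "W \<in> tors (opposite C)" for W
  proof -
    have "right_perp C (left_perp C W) = W" using O.left_right_perp[OF W] by simp
    moreover have "left_perp C W \<in> tors C" using left_perp_tors O.tors_Obj[OF W] by simp
    ultimately show ?thesis by (metis imageI)
  qed
  then show ?thesis using right_perp_tors tors_Obj by blast
qed

lemma hasse_arrow_opposite:
  assumes V: "V \<in> tors C" and W: "W \<in> tors C"
  shows "hasse_arrow (opposite C) (right_perp C V) (right_perp C W) \<longleftrightarrow> hasse_arrow C W V"
proof -
  have strict: "right_perp C B \<subset> right_perp C A \<longleftrightarrow> A \<subset> B"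
    if "A \<in> tors C" "B \<in> tors C" for A B
    using tors_subset_iff that unfolding less_le_not_le by simp
  show ?thesis
    using V W by (auto simp: hasse_arrow_def tors_opposite strict)
qed

end

section \<open>Opposite intervals\<close>

context torsion_interval
begin

lemma torsion_interval_opposite: "torsion_interval (opposite C) (right_perp C T) (right_perp C U)"
proof -
  interpret O: abelian_length_category "opposite C" by (rule abelian_length_category_opposite)
  show ?thesis
    by unfold_locales (use right_perp_tors U_Obj T_Obj right_perp_antimono[OF UT] in auto)
qed

text \<open>Both intervals have the same heart: taking the perpendicular of
  \<open>right_perp C T\<close> in the opposite category recovers \<open>T\<close>.\<close>

lemma wide_interval_opposite:
  "wide_interval (opposite C) (right_perp C T) (right_perp C U) \<longleftrightarrow> wide_interval C U T"
  by (simp add: wide_interval_def left_right_perp[OF T] Int_commute)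

lemma interval_minus_opposite:
  "interval_minus (opposite C) (right_perp C T) (right_perp C U) = right_perp C ` interval_plus C U T"
proof -
  let ?R = "\<lambda>V. right_perp C T \<subseteq> V \<and> V \<subseteq> right_perp C U \<and> hasse_arrow (opposite C) V (right_perp C T)"
  have "?R (right_perp C V) \<longleftrightarrow> U \<subseteq> V \<and> V \<subseteq> T \<and> hasse_arrow C T V" if "V \<in> tors C" for V
    using tors_subset_iff[OF that T] tors_subset_iff[OF U that] hasse_arrow_opposite[OF that T]
    by blast
  then have "{V \<in> right_perp C ` tors C. ?R V}
      = right_perp C ` {V \<in> tors C. U \<subseteq> V \<and> V \<subseteq> T \<and> hasse_arrow C T V}"
    by blast
  then show ?thesis
    by (simp add: interval_minus_def interval_plus_def tors_interval_def tors_opposite)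
qed

lemma join_interval_opposite:
  "join_interval (opposite C) (right_perp C T) (right_perp C U) \<longleftrightarrow> meet_interval C U T"
proof -
  interpret O: torsion_interval "opposite C" "right_perp C T" "right_perp C U" by (rule torsion_interval_opposite)
  let ?F = "interval_plus C U T"
  have F: "?F \<subseteq> tors C" using T by (auto simp: interval_plus_def tors_interval_def)
  \<comment> \<open>Left perpendiculars turn the union into an intersection, and each term is a
    torsion class recovered by \<open>left_right_perp\<close>. This is how a join in the opposite
    category becomes a meet.\<close>
  have "left_perp C (\<Union>(right_perp C ` ?F)) = Obj C \<inter> (\<Inter>V\<in>?F. left_perp C (right_perp C V))"
    by (auto simp: left_perp_def)
  also have "\<dots> = tors_meet C ?F" using F left_right_perp by (auto simp: tors_meet_def)
  finally have "tors_join (opposite C) (interval_minus (opposite C) (right_perp C T) (right_perp C U))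
      = right_perp C (tors_meet C ?F)"
    using O.tors_join_eq[OF O.interval_minus_tors] by (simp add: interval_minus_opposite)
  \<comment> \<open>\<open>right_perp C\<close> is injective on torsion classes, and the meet is
    one.\<close>
  moreover have "right_perp C U = right_perp C (tors_meet C ?F) \<longleftrightarrow> U = tors_meet C ?F"
    using left_right_perp U tors_meet_in_tors[OF F] by metis
  ultimately show ?thesis unfolding join_interval_def meet_interval_def by simp
qed

lemma wide_iff_meet: "wide_interval C U T \<longleftrightarrow> meet_interval C U T"
  using torsion_interval.wide_iff_join[OF torsion_interval_opposite] wide_interval_opposite join_interval_opposite
  by simp

end

theorem theorem1p6:
  fixes C :: "('o, 'a, 'x) precategory_scheme" and U T :: "'o set"
  assumes "abelian_length_category C"
    and "U \<in> tors C" and "T \<in> tors C" and "U \<subseteq> T"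
  shows "(wide_interval C U T \<longleftrightarrow> join_interval C U T) \<and>
         (join_interval C U T \<longleftrightarrow> meet_interval C U T)"
proof -
  interpret torsion_interval C U T using assms by (simp add: torsion_interval_def torsion_interval_axioms_def)
  show ?thesis using wide_iff_join wide_iff_meet by blast
qed

end
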